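(* Let $Z_\bullet$ be a finitely generated $\mathrm{FI}$-set and $(X_{t,\bullet},P)$ a connected Markov chain on $Z_\bullet$. Then there exists a virtual relation $Q$ on $Z_\bullet$ such that for $n\gg0$ the hitting time matrix $Q_n:\mathbb{R}Z_n\to\mathbb{R}Z_n$ is the specialization of $Q$ to $n$. In particular, for every stable orbit $\mathcal{O}$ of $Z_\bullet\times Z_\bullet$, the function $n\mapsto Q_n(\mathcal{O}_n)$ agrees with a rational function of $n$ for all $n\gg0$.
   Context: $\mathrm{FI}$ is the category with objects $[n]=\{1,\dots,n\}$ and injections; an $\mathrm{FI}$-set $Z_\bullet$ is a functor to finite sets with $Z_n$ its value on $[n]$ (with $\mathfrak{S}_n$-action); finitely generated means there is $d$ with $Z_{n+1}=\bigcup_f Z(f)(Z_n)$ over injections $f:[n]\hookrightarrow[n+1]$ for $n\ge d$. For $n\gg0$ the orbit sets $(Z_n\times Z_n)/\mathfrak{S}_n$ are identified with each other via maps induced by injections; a stable orbit $\mathcal{O}$ is a compatible family $(\mathcal{O}_n)_{n\gg0}$ of orbits. $r^{\mathcal{O}}_n$ is the $0/1$ matrix on $\mathbb{R}Z_n$ with $(a,b)$-entry $1$ iff $(a,b)\in\mathcal{O}_n$. A virtual relation is a formal sum $r=\sum_{\mathcal{O}}a_{\mathcal{O}}r^{\mathcal{O}}$ over stable orbits with $a_{\mathcal{O}}\in\mathbb{R}(n)$; its specialization to $n\gg0$ is $r_n=\sum a_{\mathcal{O}}(n)r^{\mathcal{O}}_n$. A transition relation is a virtual relation with $a_{\mathcal{O}}(n)\in[0,1]$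 and $r_n$ having row sums $1$ for $n\gg0$. A Markov chain on $Z_\bullet$ is a sequence of Markov chains $X_{t,n}$ on $Z_n$ whose transition matrices are, for $n\gg0$, the specializations $P_n$ of a transition relation $P$; connected means irreducible for $n\gg0$. $Q_n(a,b)=\mathbb{E}(\min\{t\ge0: X_{t,n}=b\}\mid X_{0,n}=a)$; since $Q_n$ is $\mathfrak{S}_n$-invariant, $Q_n(\mathcal{O}_n)$ denotes its common value on pairs in $\mathcal{O}_n$. *)

theory Defs
  imports "HOL-Probability.Probability"
    "HOL-Computational_Algebra.Polynomial_Factorial" "HOL-Computational_Algebra.Field_as_Ring"
begin

section \<open>FI-sets\<close>

text \<open>Morphisms \<open>[m] \<rightarrow> [n]\<close> of FI. Functions are extensional, so that equality of
  morphisms is equality in HOL and composition is \<^const>\<open>compose\<close>. In particular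
  \<open>FI n n\<close> is the symmetric group on \<open>[n]\<close>.\<close>

definition FI :: "nat \<Rightarrow> nat \<Rightarrow> (nat \<Rightarrow> nat) set" where
  "FI m n = {f \<in> {1..m} \<rightarrow>\<^sub>E {1..n}. inj_on f {1..m}}"

record 'a fi_set =
  obj :: "nat \<Rightarrow> 'a set"
  mor :: "nat \<Rightarrow> nat \<Rightarrow> (nat \<Rightarrow> nat) \<Rightarrow> 'a \<Rightarrow> 'a"

definition is_fi_set :: "'a fi_set \<Rightarrow> bool" where
  "is_fi_set Z \<longleftrightarrow>
     (\<forall>n. finite (obj Z n)) \<and>
     (\<forall>m n. \<forall>f\<in>FI m n. mor Z m n f \<in> obj Z m \<rightarrow> obj Z n) \<and>
     (\<forall>n. \<forall>x\<in>obj Z n. mor Z n n (\<lambda>i\<in>{1..n}. i) x = x) \<and>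
     (\<forall>l m n. \<forall>f\<in>FI l m. \<forall>g\<in>FI m n. \<forall>x\<in>obj Z l.
        mor Z l n (compose {1..l} g f) x = mor Z m n g (mor Z l m f x))"

definition finitely_generated :: "'a fi_set \<Rightarrow> bool" where
  "finitely_generated Z \<longleftrightarrow>
     (\<exists>d. \<forall>n\<ge>d. obj Z (Suc n) = (\<Union>f\<in>FI n (Suc n). mor Z n (Suc n) f ` obj Z n))"

section \<open>Stable orbits\<close>

definition pair_orbit :: "'a fi_set \<Rightarrow> nat \<Rightarrow> 'a \<times> 'a \<Rightarrow> ('a \<times> 'a) set" where
  "pair_orbit Z n x = (\<lambda>\<sigma>. map_prod (mor Z n n \<sigma>) (mor Z n n \<sigma>) x) ` FI n n"

definition orbits :: "'a fi_set \<Rightarrow> nat \<Rightarrow> ('a \<times> 'a) set set" where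
  "orbits Z n = pair_orbit Z n ` (obj Z n \<times> obj Z n)"

text \<open>The map from orbits at level \<open>m\<close> to orbits at level \<open>n\<close> induced by injections. For
  \<open>m \<le> n\<close> any two injections \<open>[m] \<rightarrow> [n]\<close> differ by a permutation of \<open>[n]\<close>, so the union
  over all injections is again a single orbit, namely the one that contains the image of the
  given orbit under any one injection.\<close>

definition orbit_map :: "'a fi_set \<Rightarrow> nat \<Rightarrow> nat \<Rightarrow> ('a \<times> 'a) set \<Rightarrow> ('a \<times> 'a) set" where
  "orbit_map Z m n X = (\<Union>f\<in>FI m n. map_prod (mor Z m n f) (mor Z m n f) ` X)"

definition stable_from :: "'a fi_set \<Rightarrow> nat \<Rightarrow> bool" where
  "stable_from Z N \<longleftrightarrow>
     (\<forall>m n. N \<le> m \<longrightarrow> m \<le> n \<longrightarrow> bij_betw (orbit_map Z m n) (orbits Z m) (orbits Z n))"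

text \<open>The start of the stable range; it exists for finitely generated FI-sets, see
  \<open>stable_from_stable_range\<close> below.\<close>

definition stable_range :: "'a fi_set \<Rightarrow> nat" where
  "stable_range Z = (LEAST N. stable_from Z N)"

text \<open>A compatible family given only for large \<open>n\<close> extends uniquely to the whole stable
  range. Below it the families are set to \<open>{}\<close>, so that different functions are different
  stable orbits.\<close>

definition stable_orbits :: "'a fi_set \<Rightarrow> (nat \<Rightarrow> ('a \<times> 'a) set) set" where
  "stable_orbits Z = {\<O>.
     (\<forall>n<stable_range Z. \<O> n = {}) \<and>
     (\<forall>n\<ge>stable_range Z. \<O> n \<in> orbits Z n) \<and>
     (\<forall>m n. stable_range Z \<le> m \<longrightarrow> m \<le> n \<longrightarrow> orbit_map Z m n (\<O> m) = \<O> n)}"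

lemma FI_comp:
  assumes f: "f \<in> FI l m" and g: "g \<in> FI m n"
  shows "compose {1..l} g f \<in> FI l n"
proof -
  have *: "f i \<in> {1..m}" if "i \<in> {1..l}" for i
    using f that unfolding FI_def by blast
  have "g (f i) \<in> {1..n}" if "i \<in> {1..l}" for i
    using *[OF that] g unfolding FI_def by blast
  moreover have "inj_on (compose {1..l} g f) {1..l}"
  proof (rule inj_onI)
    fix i j assume i: "i \<in> {1..l}" and j: "j \<in> {1..l}"
      and "compose {1..l} g f i = compose {1..l} g f j"
    then have "g (f i) = g (f j)" by (simp add: compose_eq)
    then have "f i = f j" using g *[OF i] *[OF j] unfolding FI_def inj_on_def by blast
    then show "i = j" using f i j unfolding FI_def inj_on_def by blast
  qed
  ultimately show ?thesis unfolding FI_def by (simp add: compose_def)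
qed

lemma FI_inclusion: "m \<le> n \<Longrightarrow> (\<lambda>i\<in>{1..m}. i) \<in> FI m n"
  unfolding FI_def inj_on_def by auto

lemma FI_transitive:
  assumes f: "f \<in> FI m n" and g: "g \<in> FI m n"
  shows "\<exists>\<sigma>\<in>FI n n. f = compose {1..m} \<sigma> g"
proof -
  have injf: "inj_on f {1..m}" and injg: "inj_on g {1..m}"
    and fm: "f ` {1..m} \<subseteq> {1..n}" and gm: "g ` {1..m} \<subseteq> {1..n}"
    and ext: "f \<in> extensional {1..m}"
    using f g unfolding FI_def PiE_def by auto
  have "card ({1..n} - g ` {1..m}) = card ({1..n} - f ` {1..m})"
    using fm gm injf injg by (simp add: card_Diff_subset card_image)
  then obtain h where h: "bij_betw h ({1..n} - g ` {1..m}) ({1..n} - f ` {1..m})"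
    using finite_same_card_bij[of "{1..n} - g ` {1..m}" "{1..n} - f ` {1..m}"] by auto
  define k where "k = (\<lambda>i. if i \<in> g ` {1..m} then f (inv_into {1..m} g i) else h i)"
  have "bij_betw (f \<circ> inv_into {1..m} g) (g ` {1..m}) (f ` {1..m})"
    by (rule bij_betw_trans[OF bij_betw_inv_into[OF inj_on_imp_bij_betw[OF injg]]
          inj_on_imp_bij_betw[OF injf]])
  then have "bij_betw k (g ` {1..m}) (f ` {1..m})"
    by (subst bij_betw_cong[where g = "f \<circ> inv_into {1..m} g"]) (auto simp: k_def)
  moreover have "bij_betw k ({1..n} - g ` {1..m}) ({1..n} - f ` {1..m})"
    using h by (subst bij_betw_cong[where g = h]) (auto simp: k_def)
  ultimately have "bij_betw k (g ` {1..m} \<union> ({1..n} - g ` {1..m}))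
      (f ` {1..m} \<union> ({1..n} - f ` {1..m}))"
    by (rule bij_betw_combine) auto
  then have k: "bij_betw k {1..n} {1..n}"
    using fm gm by (simp add: Un_absorb1)
  define \<sigma> where "\<sigma> = restrict k {1..n}"
  have "\<sigma> \<in> FI n n"
    unfolding FI_def \<sigma>_def
    using bij_betw_imp_inj_on[OF k] bij_betw_apply[OF k] by (simp del: atLeastAtMost_iff)
  moreover have "f i = compose {1..m} \<sigma> g i" for i
  proof (cases "i \<in> {1..m}")
    case True
    then have "g i \<in> {1..n}" using gm by blast
    with True show ?thesis
      using injg by (simp add: compose_def \<sigma>_def k_def)
  qed (use ext in \<open>auto simp: compose_def extensional_def\<close>)
  ultimately show ?thesis by blast
qed

lemma mor_in: "is_fi_set Z \<Longrightarrow> f \<in> FI m n \<Longrightarrow> x \<in> obj Z m \<Longrightarrow> mor Z m n f x \<in> obj Z n"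
  unfolding is_fi_set_def by blast

lemma mor_comp: "is_fi_set Z \<Longrightarrow> f \<in> FI l m \<Longrightarrow> g \<in> FI m n \<Longrightarrow> x \<in> obj Z l \<Longrightarrow>
    mor Z l n (compose {1..l} g f) x = mor Z m n g (mor Z l m f x)"
  unfolding is_fi_set_def by blast

lemma orbit_map_pair_orbit:
  assumes Z: "is_fi_set Z" and f: "f \<in> FI m n" and a: "a \<in> obj Z m" and b: "b \<in> obj Z m"
  shows "orbit_map Z m n (pair_orbit Z m (a, b)) = pair_orbit Z n (mor Z m n f a, mor Z m n f b)"
proof -
  have "orbit_map Z m n (pair_orbit Z m (a, b)) = (\<lambda>g. (mor Z m n g a, mor Z m n g b)) ` FI m n"
  proof (intro equalityI subsetI)
    fix x assume "x \<in> orbit_map Z m n (pair_orbit Z m (a, b))"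
    then obtain g \<sigma> where g: "g \<in> FI m n" and s: "\<sigma> \<in> FI m m"
      and x: "x = (mor Z m n g (mor Z m m \<sigma> a), mor Z m n g (mor Z m m \<sigma> b))"
      unfolding orbit_map_def pair_orbit_def by auto
    show "x \<in> (\<lambda>g. (mor Z m n g a, mor Z m n g b)) ` FI m n"
      unfolding x mor_comp[OF Z s g a, symmetric] mor_comp[OF Z s g b, symmetric]
      using FI_comp[OF s g] by blast
  next
    fix x assume "x \<in> (\<lambda>g. (mor Z m n g a, mor Z m n g b)) ` FI m n"
    then obtain g where g: "g \<in> FI m n" and x: "x = (mor Z m n g a, mor Z m n g b)" by auto
    have "(a, b) \<in> pair_orbit Z m (a, b)"
      unfolding pair_orbit_def
    proof (rule image_eqI)
      show "(\<lambda>i\<in>{1..m}. i) \<in> FI m m" by (simp only: FI_inclusion)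
      show "(a, b) = map_prod (mor Z m m (\<lambda>i\<in>{1..m}. i)) (mor Z m m (\<lambda>i\<in>{1..m}. i)) (a, b)"
        using Z a b unfolding is_fi_set_def by simp
    qed
    then have "x \<in> map_prod (mor Z m n g) (mor Z m n g) ` pair_orbit Z m (a, b)"
      unfolding x by (rule map_prod_imageI)
    with g show "x \<in> orbit_map Z m n (pair_orbit Z m (a, b))"
      unfolding orbit_map_def by blast
  qed
  also have "\<dots> = pair_orbit Z n (mor Z m n f a, mor Z m n f b)"
  proof (intro equalityI subsetI)
    fix x assume "x \<in> (\<lambda>g. (mor Z m n g a, mor Z m n g b)) ` FI m n"
    then obtain g where g: "g \<in> FI m n" and x: "x = (mor Z m n g a, mor Z m n g b)" by auto
    obtain \<sigma> where s: "\<sigma> \<in> FI n n" and "g = compose {1..m} \<sigma> f"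
      using FI_transitive[OF g f] by auto
    then show "x \<in> pair_orbit Z n (mor Z m n f a, mor Z m n f b)"
      unfolding pair_orbit_def x using mor_comp[OF Z f s a] mor_comp[OF Z f s b] s
      by (intro image_eqI[where x = \<sigma>]) simp_all
  next
    fix x assume "x \<in> pair_orbit Z n (mor Z m n f a, mor Z m n f b)"
    then obtain \<sigma> where s: "\<sigma> \<in> FI n n"
      and x: "x = (mor Z n n \<sigma> (mor Z m n f a), mor Z n n \<sigma> (mor Z m n f b))"
      unfolding pair_orbit_def by auto
    show "x \<in> (\<lambda>g. (mor Z m n g a, mor Z m n g b)) ` FI m n"
      unfolding x mor_comp[OF Z f s a, symmetric] mor_comp[OF Z f s b, symmetric]
      using FI_comp[OF f s] by blast
  qed
  finally show ?thesis .
qed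

lemma finite_orbits: "is_fi_set Z \<Longrightarrow> finite (orbits Z n)"
  unfolding orbits_def is_fi_set_def by auto

lemma orbit_map_in:
  assumes "is_fi_set Z" "m \<le> n" "A \<in> orbits Z m"
  shows "orbit_map Z m n A \<in> orbits Z n"
  using assms orbit_map_pair_orbit[OF assms(1) FI_inclusion[OF assms(2)]]
    mor_in[OF assms(1) FI_inclusion[OF assms(2)]]
  unfolding orbits_def by auto

lemma orbit_map_comp:
  assumes Z: "is_fi_set Z" and "l \<le> m" "m \<le> n" and A: "A \<in> orbits Z l"
  shows "orbit_map Z l n A = orbit_map Z m n (orbit_map Z l m A)"
proof -
  obtain a b where a: "a \<in> obj Z l" and b: "b \<in> obj Z l" and A: "A = pair_orbit Z l (a, b)"
    using A unfolding orbits_def by auto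
  let ?f = "\<lambda>i\<in>{1..l}. i" and ?g = "\<lambda>i\<in>{1..m}. i"
  have f: "?f \<in> FI l m" and g: "?g \<in> FI m n" using assms FI_inclusion by auto
  show ?thesis
    unfolding A orbit_map_pair_orbit[OF Z f a b] orbit_map_pair_orbit[OF Z FI_comp[OF f g] a b]
      orbit_map_pair_orbit[OF Z g mor_in[OF Z f a] mor_in[OF Z f b]]
      mor_comp[OF Z f g a] mor_comp[OF Z f g b] ..
qed

lemma obj_generated:
  assumes Z: "is_fi_set Z"
    and d: "\<forall>n\<ge>d. obj Z (Suc n) = (\<Union>f\<in>FI n (Suc n). mor Z n (Suc n) f ` obj Z n)"
    and "d \<le> n" "x \<in> obj Z n"
  shows "\<exists>f\<in>FI d n. \<exists>y\<in>obj Z d. x = mor Z d n f y"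
  using assms(3,4)
proof (induction n arbitrary: x rule: dec_induct)
  case base
  then have "x = mor Z d d (\<lambda>i\<in>{1..d}. i) x" using Z unfolding is_fi_set_def by auto
  with base FI_inclusion[of d d] show ?case by blast
next
  case (step n)
  then obtain g y where g: "g \<in> FI n (Suc n)" and y: "y \<in> obj Z n" and x: "x = mor Z n (Suc n) g y"
    using d by auto
  obtain f z where f: "f \<in> FI d n" and z: "z \<in> obj Z d" and "y = mor Z d n f z"
    using step.IH[OF y] by auto
  then have "x = mor Z d (Suc n) (compose {1..d} g f) z"
    using x mor_comp[OF Z f g z] by simp
  with FI_comp[OF f g] z show ?case by blast
qed

lemma FI_factor:
  assumes h: "h \<in> FI m n" and f: "f \<in> FI d n" and im: "f ` {1..d} \<subseteq> h ` {1..m}"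
  shows "\<exists>f'\<in>FI d m. f = compose {1..d} h f'"
proof -
  define f' where "f' = (\<lambda>i\<in>{1..d}. inv_into {1..m} h (f i))"
  have e: "h (f' i) = f i" "f' i \<in> {1..m}" if "i \<in> {1..d}" for i
  proof -
    have "f i \<in> h ` {1..m}" using that im by blast
    then show "h (f' i) = f i" "f' i \<in> {1..m}"
      unfolding f'_def using that by (simp_all add: f_inv_into_f inv_into_into del: atLeastAtMost_iff)
  qed
  have "inj_on f' {1..d}"
  proof (rule inj_onI)
    fix i j assume i: "i \<in> {1..d}" and j: "j \<in> {1..d}" and "f' i = f' j"
    then have "f i = f j" using e(1)[OF i] e(1)[OF j] by simp
    then show "i = j" using f i j unfolding FI_def inj_on_def by blast
  qed
  then have "f' \<in> FI d m"
    using e(2) unfolding FI_def by (auto simp: f'_def)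
  moreover have "f = compose {1..d} h f'"
  proof
    fix i show "f i = compose {1..d} h f' i"
      using e(1)[of i] f unfolding FI_def compose_def
      by (cases "i \<in> {1..d}") (auto simp: PiE_def extensional_def)
  qed
  ultimately show ?thesis by blast
qed

lemma orbit_map_surj:
  assumes Z: "is_fi_set Z"
    and d: "\<forall>n\<ge>d. obj Z (Suc n) = (\<Union>f\<in>FI n (Suc n). mor Z n (Suc n) f ` obj Z n)"
    and n: "2 * d \<le> n"
  shows "orbit_map Z n (Suc n) ` orbits Z n = orbits Z (Suc n)"
proof (intro equalityI subsetI)
  fix A assume "A \<in> orbits Z (Suc n)"
  then obtain a b where a: "a \<in> obj Z (Suc n)" and b: "b \<in> obj Z (Suc n)"
    and A: "A = pair_orbit Z (Suc n) (a, b)" unfolding orbits_def by auto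
  have "d \<le> Suc n" using n by simp
  from obj_generated[OF Z d this a] obj_generated[OF Z d this b]
  obtain f g a' b' where f: "f \<in> FI d (Suc n)" and g: "g \<in> FI d (Suc n)"
    and a': "a' \<in> obj Z d" "a = mor Z d (Suc n) f a'"
    and b': "b' \<in> obj Z d" "b = mor Z d (Suc n) g b'" by auto
  let ?U = "f ` {1..d} \<union> g ` {1..d}"
  have "card ?U \<le> card (f ` {1..d}) + card (g ` {1..d})" by (rule card_Un_le)
  also have "\<dots> \<le> d + d" using card_image_le[of "{1..d}" f] card_image_le[of "{1..d}" g] by simp
  finally have "card ?U < card {1..Suc n}" using n by simp
  then have "\<not> {1..Suc n} \<subseteq> ?U" using card_mono[of ?U "{1..Suc n}"] by auto
  then obtain j where j: "j \<in> {1..Suc n}" "j \<notin> ?U" by blast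
  have "card ({1..Suc n} - {j}) = card {1..n}" using j by simp
  then obtain k where k: "bij_betw k {1..n} ({1..Suc n} - {j})"
    using finite_same_card_bij[of "{1..n}" "{1..Suc n} - {j}"] by auto
  define h where "h = restrict k {1..n}"
  have him: "h ` {1..n} = {1..Suc n} - {j}"
    using bij_betw_imp_surj_on[OF k] unfolding h_def by simp
  have h: "h \<in> FI n (Suc n)"
    unfolding FI_def h_def
    using bij_betw_imp_inj_on[OF k] bij_betw_apply[OF k] by simp
  have "f ` {1..d} \<subseteq> h ` {1..n}" "g ` {1..d} \<subseteq> h ` {1..n}"
    using f g j unfolding him FI_def by auto
  then obtain f' g' where f': "f' \<in> FI d n" "f = compose {1..d} h f'"
    and g': "g' \<in> FI d n" "g = compose {1..d} h g'"
    using FI_factor[OF h f] FI_factor[OF h g] by blast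
  let ?a = "mor Z d n f' a'" and ?b = "mor Z d n g' b'"
  have "A = orbit_map Z n (Suc n) (pair_orbit Z n (?a, ?b))"
    unfolding A a' b' f'(2) g'(2)
    using orbit_map_pair_orbit[OF Z h] mor_in[OF Z f'(1) a'(1)] mor_in[OF Z g'(1) b'(1)]
      mor_comp[OF Z f'(1) h a'(1)] mor_comp[OF Z g'(1) h b'(1)] by simp
  then show "A \<in> orbit_map Z n (Suc n) ` orbits Z n"
    unfolding orbits_def using mor_in[OF Z f'(1) a'(1)] mor_in[OF Z g'(1) b'(1)] by blast
qed (use orbit_map_in[OF Z, of n "Suc n"] in auto)

text \<open>The number of orbits is eventually nonincreasing, hence eventually constant.\<close>

lemma stable_from_stable_range:
  assumes Z: "is_fi_set Z" and fg: "finitely_generated Z"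
  shows "stable_from Z (stable_range Z)"
proof -
  obtain d where d: "\<forall>n\<ge>d. obj Z (Suc n) = (\<Union>f\<in>FI n (Suc n). mor Z n (Suc n) f ` obj Z n)"
    using fg unfolding finitely_generated_def by auto
  let ?c = "\<lambda>n. card (orbits Z n)"
  have surj: "orbit_map Z n (Suc n) ` orbits Z n = orbits Z (Suc n)" if "2 * d \<le> n" for n
    using orbit_map_surj[OF Z d that] .
  have le: "?c (Suc n) \<le> ?c n" if "2 * d \<le> n" for n
    using surj[OF that] card_image_le[OF finite_orbits[OF Z]] by metis
  obtain N where N: "2 * d \<le> N" and min: "\<And>n. 2 * d \<le> n \<Longrightarrow> ?c N \<le> ?c n"
    using ex_has_least_nat[of "\<lambda>n. 2 * d \<le> n" "2 * d" ?c] by auto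
  have const: "?c n = ?c N" if "N \<le> n" for n
    using that
  proof (induction n rule: dec_induct)
    case (step n)
    then show ?case using le[of n] min[of "Suc n"] N by simp
  qed simp
  have bij: "bij_betw (orbit_map Z n (Suc n)) (orbits Z n) (orbits Z (Suc n))" if "N \<le> n" for n
  proof -
    have s: "orbit_map Z n (Suc n) ` orbits Z n = orbits Z (Suc n)"
      using surj that N by simp
    moreover have "?c (Suc n) = ?c n"
      using const[of n] const[of "Suc n"] that by simp
    ultimately show ?thesis
      unfolding bij_betw_def using eq_card_imp_inj_on[OF finite_orbits[OF Z]] by metis
  qed
  have "bij_betw (orbit_map Z m n) (orbits Z m) (orbits Z n)" if "N \<le> m" "m \<le> n" for m n
    using that(2)
  proof (induction n rule: dec_induct)
    case base
    have "orbit_map Z m m A = A" if A: "A \<in> orbits Z m" for A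
    proof -
      obtain a b where a: "a \<in> obj Z m" "b \<in> obj Z m" "A = pair_orbit Z m (a, b)"
        using A unfolding orbits_def by auto
      then show ?thesis
        using orbit_map_pair_orbit[OF Z FI_inclusion[of m m]] Z unfolding is_fi_set_def by simp
    qed
    then show ?case by (simp add: bij_betw_def inj_on_def)
  next
    case (step n)
    have "bij_betw (orbit_map Z n (Suc n) \<circ> orbit_map Z m n) (orbits Z m) (orbits Z (Suc n))"
      using step bij[of n] that(1) by (auto intro: bij_betw_trans)
    then show ?case
      using orbit_map_comp[OF Z step(1), of "Suc n"]
      by (subst bij_betw_cong[where g = "orbit_map Z n (Suc n) \<circ> orbit_map Z m n"]) auto
  qed
  then have "stable_from Z N" unfolding stable_from_def by blast
  then show ?thesis unfolding stable_range_def by (rule LeastI)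
qed

text \<open>In particular the sums over stable orbits below are finite, and at each level \<open>n\<close> of the
  stable range every orbit belongs to exactly one stable orbit.\<close>

lemma stable_orbits_bij:
  assumes Z: "is_fi_set Z" and fg: "finitely_generated Z" and n: "stable_range Z \<le> n"
  shows "bij_betw (\<lambda>\<O>. \<O> n) (stable_orbits Z) (orbits Z n)"
proof -
  let ?N = "stable_range Z"
  have st: "bij_betw (orbit_map Z m k) (orbits Z m) (orbits Z k)" if "?N \<le> m" "m \<le> k" for m k
    using stable_from_stable_range[OF Z fg] that unfolding stable_from_def by blast
  have in_orbits: "\<O> ?N \<in> orbits Z ?N" and ext: "\<And>k. k < ?N \<Longrightarrow> \<O> k = {}"
    and map: "\<And>k. ?N \<le> k \<Longrightarrow> orbit_map Z ?N k (\<O> ?N) = \<O> k" if "\<O> \<in> stable_orbits Z" for \<O>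
    using that unfolding stable_orbits_def by blast+
  let ?g = "\<lambda>A k. if k < ?N then {} else orbit_map Z ?N k A"
  have g: "?g A \<in> stable_orbits Z" if A: "A \<in> orbits Z ?N" for A
    unfolding stable_orbits_def
    using orbit_map_in[OF Z _ A] orbit_map_comp[OF Z _ _ A, symmetric] by simp
  have "bij_betw (\<lambda>\<O>. \<O> ?N) (stable_orbits Z) (orbits Z ?N)"
  proof (rule bij_betwI[where g = ?g])
    show "?g A ?N = A" if A: "A \<in> orbits Z ?N" for A
    proof -
      have "orbit_map Z ?N ?N (orbit_map Z ?N ?N A) = orbit_map Z ?N ?N A"
        by (rule orbit_map_comp[OF Z order_refl order_refl A, symmetric])
      then have "orbit_map Z ?N ?N A = A"
        by (rule inj_onD[OF bij_betw_imp_inj_on[OF st[OF order_refl order_refl]]])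
          (use A orbit_map_in[OF Z order_refl A] in simp_all)
      then show ?thesis by simp
    qed
    show "?g (\<O> ?N) = \<O>" if "\<O> \<in> stable_orbits Z" for \<O>
    proof
      fix k show "?g (\<O> ?N) k = \<O> k"
        using ext[OF that] map[OF that] by (cases "k < ?N") auto
    qed
  qed (use in_orbits g in blast)+
  then have "bij_betw (orbit_map Z ?N n \<circ> (\<lambda>\<O>. \<O> ?N)) (stable_orbits Z) (orbits Z n)"
    using st[OF order_refl n] by (rule bij_betw_trans)
  moreover have "(orbit_map Z ?N n \<circ> (\<lambda>\<O>. \<O> ?N)) \<O> = \<O> n" if "\<O> \<in> stable_orbits Z" for \<O>
    using map[OF that n] by simp
  ultimately show ?thesis
    using bij_betw_cong[of "stable_orbits Z" "orbit_map Z ?N n \<circ> (\<lambda>\<O>. \<O> ?N)" "\<lambda>\<O>. \<O> n"] by blast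
qed

lemma finite_stable_orbits: "is_fi_set Z \<Longrightarrow> finitely_generated Z \<Longrightarrow> finite (stable_orbits Z)"
  using bij_betw_finite[OF stable_orbits_bij] finite_orbits by blast

section \<open>Virtual relations\<close>

text \<open>The field of rational functions is \<^typ>\<open>real poly fract\<close>. Evaluation uses the
  representation in lowest terms; at the finitely many poles the value is \<open>0\<close>.\<close>

definition eval_rat :: "real poly fract \<Rightarrow> real \<Rightarrow> real" where
  "eval_rat q x = poly (fst (quot_of_fract q)) x / poly (snd (quot_of_fract q)) x"

definition orbit_relation :: "(nat \<Rightarrow> ('a \<times> 'a) set) \<Rightarrow> nat \<Rightarrow> 'a \<Rightarrow> 'a \<Rightarrow> real" where
  "orbit_relation \<O> n a b = of_bool ((a, b) \<in> \<O> n)"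

text \<open>A formal sum is its family of coefficients.\<close>

type_synonym 'a vrel = "(nat \<Rightarrow> ('a \<times> 'a) set) \<Rightarrow> real poly fract"

definition virtual_relations :: "'a fi_set \<Rightarrow> 'a vrel set" where
  "virtual_relations Z = stable_orbits Z \<rightarrow>\<^sub>E UNIV"

definition specialize :: "'a fi_set \<Rightarrow> 'a vrel \<Rightarrow> nat \<Rightarrow> 'a \<Rightarrow> 'a \<Rightarrow> real" where
  "specialize Z r n a b = (\<Sum>\<O>\<in>stable_orbits Z. eval_rat (r \<O>) (real n) * orbit_relation \<O> n a b)"

definition transition_relation :: "'a fi_set \<Rightarrow> 'a vrel \<Rightarrow> bool" where
  "transition_relation Z P \<longleftrightarrow> P \<in> virtual_relations Z \<and>
     (\<forall>\<^sub>F n in sequentially.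
        (\<forall>\<O>\<in>stable_orbits Z. eval_rat (P \<O>) (real n) \<in> {0..1}) \<and>
        (\<forall>a\<in>obj Z n. (\<Sum>b\<in>obj Z n. specialize Z P n a b) = 1))"

section \<open>Markov chains\<close>

text \<open>A time-homogeneous Markov chain \<open>X\<close> on \<open>S\<close> with transition matrix \<open>p\<close>. Every state has
  positive initial probability, so that conditioning on \<open>X 0 = a\<close> makes sense for each \<open>a\<close>.\<close>

definition markov_chain ::
    "'a set \<Rightarrow> ('a \<Rightarrow> 'a \<Rightarrow> real) \<Rightarrow> 'w measure \<Rightarrow> (nat \<Rightarrow> 'w \<Rightarrow> 'a) \<Rightarrow> bool" where
  "markov_chain S p M X \<longleftrightarrow>
     prob_space M \<and>
     (\<forall>t. X t \<in> M \<rightarrow>\<^sub>M count_space S) \<and>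
     (\<forall>a\<in>S. \<P>(\<omega> in M. X 0 \<omega> = a) > 0) \<and>
     (\<forall>t x. \<forall>y\<in>S. \<P>(\<omega> in M. \<forall>s\<le>t. X s \<omega> = x s) > 0 \<longrightarrow>
        \<P>(\<omega> in M. X (Suc t) \<omega> = y \<bar> \<forall>s\<le>t. X s \<omega> = x s) = p (x t) y)"

definition irreducible_chain :: "'a set \<Rightarrow> 'w measure \<Rightarrow> (nat \<Rightarrow> 'w \<Rightarrow> 'a) \<Rightarrow> bool" where
  "irreducible_chain S M X \<longleftrightarrow>
     (\<forall>a\<in>S. \<forall>b\<in>S. \<exists>t. \<P>(\<omega> in M. X t \<omega> = b \<bar> X 0 \<omega> = a) > 0)"

text \<open>\<open>\<infinity>\<close> if \<open>b\<close> is never hit.\<close>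

definition hitting_time :: "(nat \<Rightarrow> 'w \<Rightarrow> 'a) \<Rightarrow> 'a \<Rightarrow> 'w \<Rightarrow> ennreal" where
  "hitting_time X b \<omega> = (INF t\<in>{t. X t \<omega> = b}. of_nat t)"

text \<open>The expected hitting time conditional on the event \<open>X 0 = a\<close>.\<close>

definition hitting_matrix :: "'w measure \<Rightarrow> (nat \<Rightarrow> 'w \<Rightarrow> 'a) \<Rightarrow> 'a \<Rightarrow> 'a \<Rightarrow> ennreal" where
  "hitting_matrix M X a b =
     (\<integral>\<^sup>+ \<omega>. hitting_time X b \<omega> \<partial>uniform_measure M {\<omega> \<in> space M. X 0 \<omega> = a})"

text \<open>There are no Markov chains on the empty set, hence the restriction to nonempty
  \<open>obj Z n\<close>. For small \<open>n\<close> the transition matrix is arbitrary.\<close>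

definition fi_markov_chain ::
    "'a fi_set \<Rightarrow> 'a vrel \<Rightarrow> (nat \<Rightarrow> 'w measure) \<Rightarrow> (nat \<Rightarrow> nat \<Rightarrow> 'w \<Rightarrow> 'a) \<Rightarrow> bool" where
  "fi_markov_chain Z P M X \<longleftrightarrow> transition_relation Z P \<and>
     (\<forall>n. obj Z n \<noteq> {} \<longrightarrow> (\<exists>p. markov_chain (obj Z n) p (M n) (X n))) \<and>
     (\<forall>\<^sub>F n in sequentially. obj Z n \<noteq> {} \<longrightarrow>
        markov_chain (obj Z n) (specialize Z P n) (M n) (X n))"

definition connected_chain ::
    "'a fi_set \<Rightarrow> (nat \<Rightarrow> 'w measure) \<Rightarrow> (nat \<Rightarrow> nat \<Rightarrow> 'w \<Rightarrow> 'a) \<Rightarrow> bool" where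
  "connected_chain Z M X \<longleftrightarrow>
     (\<forall>\<^sub>F n in sequentially. irreducible_chain (obj Z n) (M n) (X n))"

end

theory Submission
  imports Defs
begin

text \<open>
  Hitting times to \<open>b\<close> are the solution of \<open>g b = 0\<close>, \<open>g a = 1 + (\<Sum>c. p a c * g c)\<close>. The kernel
  \<open>p\<close> is invariant under the symmetric group, so one may look for a solution that is constant on
  orbits of pairs; this turns the equations into a square linear system indexed by the stable
  orbits, whose size does not depend on \<open>n\<close>. Its coefficients are rational functions of \<open>n\<close>, as they
  count the \<open>c\<close> such that \<open>(a, c)\<close> and \<open>(c, b)\<close> lie in prescribed orbits. An element of the kernel over
  the field of rational functions would specialize, for large \<open>n\<close>, to a function harmonic off \<open>b\<close>
  and vanishing at \<open>b\<close>, which is zero by irreducibility. Hence the system is solvable over the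
  field of rational functions, and any solution of it specializes to the hitting times.
\<close>

section \<open>Evaluation of rational functions\<close>

text \<open>The obstacle is that evaluation at \<open>n\<close> is not a homomorphism on the field
  of rational functions: each algebraic identity survives it only for large \<open>n\<close>. Hence
  only finitely many identities may be evaluated, which is achieved by imposing the equations at one
  representative pair per stable orbit.

  The counts are rational because of generators. For large \<open>n\<close>, the elements at level
  \<open>n\<close> are the images of one fixed finite set under injections from \<open>[d]\<close>
  to \<open>[n]\<close>, so a sum over elements is a sum over generators and injections, weighted by
  the inverse of the number of ways to produce the element. The summands do not change under
  permutations fixing the bounded set of points that carries \<open>a\<close> and \<open>b\<close>;
  the injections can therefore be replaced by a bounded set of them, with weights polynomial in
  \<open>n\<close>. Whether such an injection contributes is a condition that persists from
  \<open>n\<close> to \<open>n + 1\<close> and so is eventually constant.\<close>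

lemma eventually_poly_nonzero:
  fixes p :: "real poly"
  assumes "p \<noteq> 0"
  shows "\<forall>\<^sub>F n in sequentially. poly p (real n) \<noteq> 0"
proof -
  have "finite (real -` {x. poly p x = 0})"
    using poly_roots_finite[OF assms] by (rule finite_vimageI) (simp add: inj_on_def)
  then show ?thesis
    unfolding cofinite_eq_sequentially[symmetric] eventually_cofinite vimage_def by simp
qed

text \<open>Evaluation uses the reduced fraction. Cross-multiplication shows that any other
  representative has the same value wherever neither denominator vanishes, which excludes only
  finitely many \<open>n\<close>.\<close>

lemma eventually_eval_rat_Fract:
  assumes "b \<noteq> 0"
  shows "\<forall>\<^sub>F n in sequentially. eval_rat (Fract a b) (real n) = poly a (real n) / poly b (real n)"
proof -
  define x where "x = fst (quot_of_fract (Fract a b))"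
  define y where "y = snd (quot_of_fract (Fract a b))"
  have y: "y \<noteq> 0" unfolding y_def by simp
  have "Fract x y = Fract a b" unfolding x_def y_def by simp
  then have xy: "x * b = a * y" using y assms by (simp add: eq_fract)
  show ?thesis
    using eventually_poly_nonzero[OF y] eventually_poly_nonzero[OF assms]
  proof eventually_elim
    case (elim n)
    have "poly x (real n) * poly b (real n) = poly a (real n) * poly y (real n)"
      using xy by (metis poly_mult)
    then show ?case
      unfolding eval_rat_def x_def[symmetric] y_def[symmetric] using elim by (simp add: field_simps)
  qed
qed

lemma eventually_eval_rat_add:
  "\<forall>\<^sub>F n in sequentially. eval_rat (p + q) (real n) = eval_rat p (real n) + eval_rat q (real n)"
proof (cases p, cases q)
  fix a b c d assume *: "p = Fract a b" "b \<noteq> 0" "q = Fract c d" "d \<noteq> 0"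
  have "b * d \<noteq> 0" using * by simp
  from eventually_eval_rat_Fract[OF this, of "a * d + c * b"]
    eventually_eval_rat_Fract[OF *(2), of a] eventually_eval_rat_Fract[OF *(4), of c]
    eventually_poly_nonzero[OF *(2)] eventually_poly_nonzero[OF *(4)]
  show ?thesis unfolding * by eventually_elim (simp add: * add_frac_eq)
qed

lemma eventually_eval_rat_mult:
  "\<forall>\<^sub>F n in sequentially. eval_rat (p * q) (real n) = eval_rat p (real n) * eval_rat q (real n)"
proof (cases p, cases q)
  fix a b c d assume *: "p = Fract a b" "b \<noteq> 0" "q = Fract c d" "d \<noteq> 0"
  have "b * d \<noteq> 0" using * by simp
  from eventually_eval_rat_Fract[OF this, of "a * c"]
    eventually_eval_rat_Fract[OF *(2), of a] eventually_eval_rat_Fract[OF *(4), of c]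
  show ?thesis unfolding * by eventually_elim simp
qed

lemma eventually_eval_rat_poly:
  "\<forall>\<^sub>F n in sequentially. eval_rat (Fract p 1) (real n) = poly p (real n)"
  using eventually_eval_rat_Fract[of 1 p] by simp

lemma eventually_eval_rat_const:
  "\<forall>\<^sub>F n in sequentially. eval_rat (Fract [:c:] 1) (real n) = c"
  using eventually_eval_rat_poly[of "[:c:]"] by simp

lemma eventually_eval_rat_inverse:
  "\<forall>\<^sub>F n in sequentially. eval_rat (inverse p) (real n) = inverse (eval_rat p (real n))"
proof (cases p)
  case (Fract a b)
  show ?thesis
  proof (cases "a = 0")
    \<comment> \<open>The inverse of 0 is 0 both in the fraction field and in the reals, so both
      sides vanish.\<close>
    case True
    then show ?thesis by (simp add: Fract fract_collapse eval_rat_def)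
  next
    case False
    from eventually_eval_rat_Fract[OF this, of b] eventually_eval_rat_Fract[OF Fract(2), of a]
    show ?thesis unfolding Fract by eventually_elim simp
  qed
qed

lemma eventually_eval_rat_sum:
  assumes "finite I"
  shows "\<forall>\<^sub>F n in sequentially. eval_rat (\<Sum>i\<in>I. f i) (real n) = (\<Sum>i\<in>I. eval_rat (f i) (real n))"
  using assms
proof induction
  case empty
  show ?case using eventually_eval_rat_const[of 0] by (simp add: Zero_fract_def)
next
  case (insert i I)
  from insert.IH eventually_eval_rat_add[of "f i" "\<Sum>i\<in>I. f i"]
  show ?case by eventually_elim (simp add: insert.hyps)
qed

text \<open>A nonzero fraction has a nonzero numerator, which has only finitely many roots. This is
  the way back from identities at all large \<open>n\<close> to identities in the field.\<close>

lemma eval_rat_eventually_0_imp_0: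
  assumes "\<forall>\<^sub>F n in sequentially. eval_rat p (real n) = 0"
  shows "p = 0"
proof (cases p)
  case (Fract a b)
  have "a = 0"
  proof (rule ccontr)
    assume "a \<noteq> 0"
    from assms eventually_eval_rat_Fract[OF Fract(2), of a] eventually_poly_nonzero[OF Fract(2)]
      eventually_poly_nonzero[OF this]
    have "\<forall>\<^sub>F n in sequentially. False" unfolding Fract by eventually_elim simp
    then show False by simp
  qed
  then show ?thesis using Fract by (simp add: fract_collapse)
qed

text \<open>A predicate on sequences that hides the field element, so that closure under sums,
  products and inverses applies directly to formulas in \<open>n\<close>.\<close>

definition eventually_rational :: "(nat \<Rightarrow> real) \<Rightarrow> bool" where
  "eventually_rational f \<longleftrightarrow> (\<exists>q. \<forall>\<^sub>F n in sequentially. f n = eval_rat q (real n))"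

lemma eventually_rational_cong:
  assumes "eventually_rational f" "\<forall>\<^sub>F n in sequentially. g n = f n"
  shows "eventually_rational g"
  using assms eventually_elim2[of _ sequentially] unfolding eventually_rational_def
  by (metis (mono_tags, lifting))

lemma eventually_rational_eval_rat: "eventually_rational (\<lambda>n. eval_rat q (real n))"
  unfolding eventually_rational_def by (intro exI[of _ q]) simp

lemma eventually_rational_poly: "eventually_rational (\<lambda>n. poly p (real n))"
  using eventually_rational_cong[OF eventually_rational_eval_rat] eventually_eval_rat_poly[of p]
  by (simp add: eq_commute)

lemma eventually_rational_const: "eventually_rational (\<lambda>n. c)"
  using eventually_rational_poly[of "[:c:]"] by simp

lemma eventually_rational_mult:
  assumes "eventually_rational f" "eventually_rational g"
  shows "eventually_rational (\<lambda>n. f n * g n)"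
proof -
  obtain p q where "\<forall>\<^sub>F n in sequentially. f n = eval_rat p (real n)"
    "\<forall>\<^sub>F n in sequentially. g n = eval_rat q (real n)"
    using assms unfolding eventually_rational_def by auto
  with eventually_eval_rat_mult[of p q]
  have "\<forall>\<^sub>F n in sequentially. f n * g n = eval_rat (p * q) (real n)" by eventually_elim simp
  then show ?thesis unfolding eventually_rational_def by blast
qed

lemma eventually_rational_inverse:
  assumes "eventually_rational f"
  shows "eventually_rational (\<lambda>n. inverse (f n))"
proof -
  obtain p where "\<forall>\<^sub>F n in sequentially. f n = eval_rat p (real n)"
    using assms unfolding eventually_rational_def by auto
  with eventually_eval_rat_inverse[of p]
  have "\<forall>\<^sub>F n in sequentially. inverse (f n) = eval_rat (inverse p) (real n)"
    by eventually_elim simp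
  then show ?thesis unfolding eventually_rational_def by blast
qed

lemma eventually_rational_sum:
  assumes "\<And>i. i \<in> I \<Longrightarrow> eventually_rational (f i)"
  shows "eventually_rational (\<lambda>n. \<Sum>i\<in>I. f i n)"
proof (cases "finite I")
  case True
  obtain q where q: "\<And>i. i \<in> I \<Longrightarrow> \<forall>\<^sub>F n in sequentially. f i n = eval_rat (q i) (real n)"
    using assms unfolding eventually_rational_def by metis
  then have "\<forall>\<^sub>F n in sequentially. \<forall>i\<in>I. f i n = eval_rat (q i) (real n)"
    using True by (simp add: eventually_ball_finite)
  with eventually_eval_rat_sum[OF True, of q]
  have "\<forall>\<^sub>F n in sequentially. (\<Sum>i\<in>I. f i n) = eval_rat (\<Sum>i\<in>I. q i) (real n)"
    by eventually_elim simp
  then show ?thesis unfolding eventually_rational_def by blast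
qed (simp add: eventually_rational_const)

text \<open>From \<open>N\<close> on the truth value can switch only from false to true, so it is
  eventually constant. The intended conditions are equalities and memberships that are preserved by
  the inclusion of \<open>[n]\<close> in \<open>[n + 1]\<close>.\<close>

lemma eventually_rational_of_bool_mono:
  assumes "\<And>n. N \<le> n \<Longrightarrow> P n \<Longrightarrow> P (Suc n)"
  shows "eventually_rational (\<lambda>n. of_bool (P n))"
proof (cases "\<exists>n\<ge>N. P n")
  case True
  then obtain k where k: "N \<le> k" "P k" by blast
  have "P n" if "k \<le> n" for n
    using that by (induction n rule: dec_induct) (use k assms in auto)
  then have "\<forall>\<^sub>F n in sequentially. of_bool (P n) = (1 :: real)"
    unfolding eventually_sequentially by (intro exI[of _ k]) simp
  then show ?thesis by (rule eventually_rational_cong[OF eventually_rational_const])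
next
  case False
  then have "\<forall>\<^sub>F n in sequentially. of_bool (P n) = (0 :: real)"
    unfolding eventually_sequentially by (intro exI[of _ N]) auto
  then show ?thesis by (rule eventually_rational_cong[OF eventually_rational_const])
qed

section \<open>Linear systems over a field\<close>

text \<open>Gaussian elimination, one equation at a time: an equation with zero coefficients is
  dropped, any other is solved for one unknown. Either way the unknowns still outnumber the
  equations.\<close>

lemma underdetermined_system:
  fixes A :: "'i \<Rightarrow> 'j \<Rightarrow> 'k :: field"
  assumes "finite I" "finite J" "card I < card J"
  shows "\<exists>v. (\<exists>j\<in>J. v j \<noteq> 0) \<and> (\<forall>i\<in>I. (\<Sum>j\<in>J. A i j * v j) = 0)"
  using assms
proof (induction I arbitrary: J A rule: finite_induct)
  case empty
  then have "J \<noteq> {}" by auto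
  then show ?case by (intro exI[of _ "\<lambda>_. 1"]) auto
next
  case (insert i I)
  show ?case
  proof (cases "\<forall>j\<in>J. A i j = 0")
    case True
    have "card I < card J" using insert by simp
    from insert.IH[OF insert.prems(1) this, of A] True show ?thesis by auto
  next
    case False
    then obtain l where l: "l \<in> J" "A i l \<noteq> 0" by blast
    \<comment> \<open>Row \<open>k\<close> minus the multiple of row \<open>i\<close> that clears
      column \<open>l\<close>. The unknown at \<open>l\<close> is recovered from equation
      \<open>i\<close> afterwards.\<close>
    define B where "B k j = A k j - A k l * A i j / A i l" for k j
    have "card I < card (J - {l})" using insert l by simp
    then obtain v where v: "\<exists>j\<in>J - {l}. v j \<noteq> 0"
      and z: "\<And>k. k \<in> I \<Longrightarrow> (\<Sum>j\<in>J - {l}. B k j * v j) = 0"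
      using insert.IH[of "J - {l}" B] insert.prems(1) by auto
    define s where "s = (\<Sum>j\<in>J - {l}. A i j * v j)"
    define w where "w = v(l := - s / A i l)"
    have sum_w: "(\<Sum>j\<in>J. A k j * w j) = (\<Sum>j\<in>J - {l}. A k j * v j) - A k l * s / A i l" for k
    proof -
      have "(\<Sum>j\<in>J. A k j * w j) = A k l * w l + (\<Sum>j\<in>J - {l}. A k j * w j)"
        using l insert.prems by (simp add: sum.remove)
      also have "(\<Sum>j\<in>J - {l}. A k j * w j) = (\<Sum>j\<in>J - {l}. A k j * v j)"
        by (rule sum.cong) (auto simp: w_def)
      finally show ?thesis by (simp add: w_def)
    qed
    have "(\<Sum>j\<in>J. A k j * w j) = 0" if "k \<in> I" for k
    proof -
      have "(\<Sum>j\<in>J - {l}. A k j * v j) - A k l * s / A i l = (\<Sum>j\<in>J - {l}. B k j * v j)"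
        unfolding B_def s_def
        by (simp add: algebra_simps sum_subtractf sum_distrib_left sum_divide_distrib)
      then show ?thesis using z[OF that] sum_w by simp
    qed
    moreover have "(\<Sum>j\<in>J. A i j * w j) = 0" using sum_w[of i] l by (simp add: s_def)
    moreover have "\<exists>j\<in>J. w j \<noteq> 0" using v by (auto simp: w_def)
    ultimately show ?thesis by blast
  qed
qed

text \<open>With \<open>w\<close> adjoined as a column, indexed by \<open>None\<close>, there are
  more unknowns than equations. By injectivity a nontrivial solution has a nonzero coefficient at
  \<open>w\<close>, and dividing by minus this coefficient solves the system.\<close>

lemma injective_system_solvable:
  fixes A :: "'i \<Rightarrow> 'i \<Rightarrow> 'k :: field"
  assumes I: "finite I"
    and inj: "\<And>v. \<forall>i\<in>I. (\<Sum>j\<in>I. A i j * v j) = 0 \<Longrightarrow> \<forall>j\<in>I. v j = 0"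
  shows "\<exists>v. \<forall>i\<in>I. (\<Sum>j\<in>I. A i j * v j) = w i"
proof -
  define B where "B i j = (case j of None \<Rightarrow> w i | Some j \<Rightarrow> A i j)" for i j
  have fin: "finite (insert None (Some ` I))" using I by simp
  have "card I < card (insert None (Some ` I))"
    using I by (simp add: card_insert_if card_image)
  from underdetermined_system[OF I fin this, of B]
  obtain v where v: "\<exists>j\<in>insert None (Some ` I). v j \<noteq> 0"
    and z: "\<And>i. i \<in> I \<Longrightarrow> w i * v None + (\<Sum>j\<in>I. A i j * v (Some j)) = 0"
    using I by (auto simp: B_def sum.reindex)
  have "v None \<noteq> 0"
  proof
    assume "v None = 0"
    with inj[of "\<lambda>j. v (Some j)"] z v show False by auto
  qed
  then have "(\<Sum>j\<in>I. A i j * (- v (Some j) / v None)) = w i" if "i \<in> I" for i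
  proof -
    have "(\<Sum>j\<in>I. A i j * (- v (Some j) / v None)) = - (\<Sum>j\<in>I. A i j * v (Some j)) / v None"
      by (simp add: sum_divide_distrib sum_negf)
    also have "(\<Sum>j\<in>I. A i j * v (Some j)) = - (w i * v None)"
      using z[OF that] by (simp add: add_eq_0_iff)
    finally show ?thesis using \<open>v None \<noteq> 0\<close> by simp
  qed
  then show ?thesis by (intro exI[of _ "\<lambda>j. - v (Some j) / v None"]) blast
qed

section \<open>Hitting times of finite Markov chains\<close>

text \<open>The expectation of \<open>h (X k)\<close> on the event that \<open>X 0, \<dots>, X k\<close> avoid \<open>b\<close>, for the chain started
  at \<open>a\<close>.\<close>

primrec killed :: "'a set \<Rightarrow> ('a \<Rightarrow> 'a \<Rightarrow> real) \<Rightarrow> 'a \<Rightarrow> ('a \<Rightarrow> real) \<Rightarrow> nat \<Rightarrow> 'a \<Rightarrow> real" where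
  "killed S p b h 0 a = of_bool (a \<noteq> b) * h a"
| "killed S p b h (Suc k) a = of_bool (a \<noteq> b) * (\<Sum>c\<in>S. p a c * killed S p b h k c)"

text \<open>For \<open>h = 1\<close> the killed expectation is the probability of avoiding
  \<open>b\<close> up to time \<open>k\<close>. The kernel is nonnegative, so the bound on
  \<open>h\<close> passes through each step.\<close>

lemma abs_killed_le:
  assumes p: "\<And>a c. a \<in> S \<Longrightarrow> c \<in> S \<Longrightarrow> 0 \<le> p a c" and h: "\<And>a. a \<in> S \<Longrightarrow> \<bar>h a\<bar> \<le> C"
    and "a \<in> S"
  shows "\<bar>killed S p b h k a\<bar> \<le> C * killed S p b (\<lambda>_. 1) k a"
  using \<open>a \<in> S\<close>
proof (induction k arbitrary: a)
  case (Suc k)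
  have "\<bar>\<Sum>c\<in>S. p a c * killed S p b h k c\<bar> \<le> (\<Sum>c\<in>S. p a c * (C * killed S p b (\<lambda>_. 1) k c))"
    using p Suc by (intro order_trans[OF sum_abs] sum_mono) (simp add: abs_mult mult_left_mono)
  also have "\<dots> = C * (\<Sum>c\<in>S. p a c * killed S p b (\<lambda>_. 1) k c)"
    by (simp add: sum_distrib_left algebra_simps)
  finally show ?case by simp
qed (use h in simp)

lemma killed_one_nonneg:
  assumes "\<And>a c. a \<in> S \<Longrightarrow> c \<in> S \<Longrightarrow> 0 \<le> p a c" "a \<in> S"
  shows "0 \<le> killed S p b (\<lambda>_. 1) k a"
  using abs_killed_le[where h = "\<lambda>_. 1" and C = 1 and S = S and p = p and a = a and b = b and k = k] assms
  by simp

lemma killed_one_le_one: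
  assumes p: "\<And>a c. a \<in> S \<Longrightarrow> c \<in> S \<Longrightarrow> 0 \<le> p a c" and sum1: "\<And>a. a \<in> S \<Longrightarrow> (\<Sum>c\<in>S. p a c) = 1"
    and "a \<in> S"
  shows "killed S p b (\<lambda>_. 1) k a \<le> 1"
  using \<open>a \<in> S\<close>
proof (induction k arbitrary: a)
  case (Suc k)
  have "(\<Sum>c\<in>S. p a c * killed S p b (\<lambda>_. 1) k c) \<le> (\<Sum>c\<in>S. p a c * 1)"
    using p Suc by (intro sum_mono mult_left_mono) auto
  then show ?case using sum1[OF Suc.prems] by simp
qed simp

text \<open>Let K be the kernel \<open>p\<close> with the row of \<open>b\<close> set to 0. The
  equations say that \<open>g\<close> is \<theta> off \<open>b\<close> plus K \<open>g\<close>, and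
  the k-th power of K is applied to this. The cases of interest are \<theta> = 1 for expected
  hitting times and \<theta> = 0 for harmonic functions.\<close>

lemma killed_step:
  assumes g: "g b = 0" "\<And>a. a \<in> S \<Longrightarrow> a \<noteq> b \<Longrightarrow> g a = \<theta> + (\<Sum>c\<in>S. p a c * g c)" and "a \<in> S"
  shows "killed S p b g k a = \<theta> * killed S p b (\<lambda>_. 1) k a + killed S p b g (Suc k) a"
  using \<open>a \<in> S\<close>
proof (induction k arbitrary: a)
  case 0
  have "(\<Sum>c\<in>S. p a c * (of_bool (c \<noteq> b) * g c)) = (\<Sum>c\<in>S. p a c * g c)"
    using g(1) by (intro sum.cong) auto
  then show ?case using g(1) g(2)[OF 0] by (cases "a = b") simp_all
next
  case (Suc k)
  have "killed S p b g (Suc k) a = of_bool (a \<noteq> b) *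
      (\<Sum>c\<in>S. p a c * (\<theta> * killed S p b (\<lambda>_. 1) k c + killed S p b g (Suc k) c))"
    unfolding killed.simps(2)[of S p b g k a] using Suc.IH by simp
  also have "\<dots> = \<theta> * killed S p b (\<lambda>_. 1) (Suc k) a + killed S p b g (Suc (Suc k)) a"
    unfolding killed.simps(2)[of S p b _ k a] killed.simps(2)[of S p b g "Suc k" a]
    by (simp only: distrib_left sum.distrib) (simp add: sum_distrib_left algebra_simps)
  finally show ?case .
qed

lemma killed_telescope:
  assumes g: "g b = 0" "\<And>a. a \<in> S \<Longrightarrow> a \<noteq> b \<Longrightarrow> g a = \<theta> + (\<Sum>c\<in>S. p a c * g c)" and a: "a \<in> S"
  shows "g a = \<theta> * (\<Sum>k<t. killed S p b (\<lambda>_. 1) k a) + killed S p b g t a"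
proof (induction t)
  case 0
  then show ?case using g(1) by auto
next
  case (Suc t)
  have "killed S p b g t a = \<theta> * killed S p b (\<lambda>_. 1) t a + killed S p b g (Suc t) a"
    using assms by (rule killed_step)
  then show ?case using Suc by (simp only: sum.lessThan_Suc distrib_left)
qed

text \<open>A real-valued solution forces the avoidance probabilities to be summable: their partial
  sums differ from \<open>g a\<close> by a remainder of modulus at most \<open>C\<close>.
  Summability sends the probabilities to 0, and with them the remainder, which is bounded by
  \<open>C\<close> times the probability.\<close>

lemma killed_one_sums:
  assumes S: "finite S" and p: "\<And>a c. a \<in> S \<Longrightarrow> c \<in> S \<Longrightarrow> 0 \<le> p a c"
    and sum1: "\<And>a. a \<in> S \<Longrightarrow> (\<Sum>c\<in>S. p a c) = 1"
    and g: "g b = 0" "\<And>a. a \<in> S \<Longrightarrow> a \<noteq> b \<Longrightarrow> g a = 1 + (\<Sum>c\<in>S. p a c * g c)" and a: "a \<in> S"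
  shows "(\<lambda>k. killed S p b (\<lambda>_. 1) k a) sums g a"
proof -
  let ?u = "\<lambda>k. killed S p b (\<lambda>_. 1) k a"
  define C where "C = (\<Sum>a\<in>S. \<bar>g a\<bar>)"
  have C: "\<bar>g c\<bar> \<le> C" if "c \<in> S" for c
    unfolding C_def by (rule member_le_sum) (use S that in auto)
  then have "0 \<le> C" using a by fastforce
  have tele: "g a = (\<Sum>k<t. ?u k) + killed S p b g t a" for t
    using killed_telescope[where g = g and \<theta> = 1 and t = t and p = p and S = S and b = b, OF g a] by simp
  have rest: "\<bar>killed S p b g t a\<bar> \<le> C * ?u t" for t
    by (rule abs_killed_le) (use p C a in auto)
  have "(\<Sum>k<t. ?u k) \<le> 2 * C" for t
  proof -
    have "C * ?u t \<le> C * 1"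
      using \<open>0 \<le> C\<close> killed_one_le_one[where S = S and p = p] p sum1 a by (intro mult_left_mono) auto
    then show ?thesis using tele[of t] rest[of t] C[OF a] by linarith
  qed
  then have "summable ?u"
    by (intro summableI_nonneg_bounded) (use killed_one_nonneg[where S = S and p = p] p a in auto)
  then have "(\<lambda>t. C * ?u t) \<longlonglongrightarrow> C * 0" by (intro tendsto_mult_left summable_LIMSEQ_zero)
  then have "(\<lambda>t. killed S p b g t a) \<longlonglongrightarrow> 0"
    using rest by (intro Lim_null_comparison[of "\<lambda>t. killed S p b g t a"]) auto
  then have "(\<lambda>t. g a - killed S p b g t a) \<longlonglongrightarrow> g a - 0" by (intro tendsto_intros)
  moreover have "(\<lambda>t. g a - killed S p b g t a) = (\<lambda>t. \<Sum>k<t. ?u k)" 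
  proof
    show "g a - killed S p b g t a = (\<Sum>k<t. ?u k)" for t using tele[of t] by linarith
  qed
  ultimately show ?thesis unfolding sums_def by simp
qed

section \<open>Avoidance probabilities, expected hitting times and the maximum principle\<close>

lemma markov_chain_pred:
  assumes "markov_chain S p M X"
  shows "Measurable.pred M (\<lambda>\<omega>. Q (X t \<omega>))"
proof (rule measurable_compose[where N = "count_space S"])
  show "X t \<in> M \<rightarrow>\<^sub>M count_space S" using assms unfolding markov_chain_def by blast
qed simp

lemma All_le_Suc2: "(\<forall>s\<le>Suc k. Q s) \<longleftrightarrow> Q 0 \<and> (\<forall>s\<le>k. Q (Suc s))"
  by (metis Suc_le_mono bot_nat_0.extremum not0_implies_Suc)

text \<open>Induction on \<open>k\<close> for all histories at once: splitting by the state
  \<open>y\<close> at time \<open>t + 1\<close> lengthens the history by \<open>y\<close>. The whole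
  past is prescribed, not only \<open>X t\<close>, to match the form of the Markov property.\<close>

lemma markov_chain_prob_avoid:
  assumes mc: "markov_chain S p M X" and S: "finite S" and x: "x t \<in> S"
  shows "\<P>(\<omega> in M. (\<forall>s\<le>t. X s \<omega> = x s) \<and> (\<forall>s\<le>k. X (t + s) \<omega> \<noteq> b)) =
    \<P>(\<omega> in M. \<forall>s\<le>t. X s \<omega> = x s) * killed S p b (\<lambda>_. 1) k (x t)"
  using x
proof (induction k arbitrary: t x)
  case 0
  show ?case
  proof (cases "x t = b")
    case True
    then have "{\<omega> \<in> space M. (\<forall>s\<le>t. X s \<omega> = x s) \<and> (\<forall>s\<le>0. X (t + s) \<omega> \<noteq> b)} = {}" by auto
    with True show ?thesis by (simp only: measure_empty) simp
  next
    case False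
    then have "{\<omega> \<in> space M. (\<forall>s\<le>t. X s \<omega> = x s) \<and> (\<forall>s\<le>0. X (t + s) \<omega> \<noteq> b)} =
      {\<omega> \<in> space M. \<forall>s\<le>t. X s \<omega> = x s}" by auto
    with False show ?thesis by simp
  qed
next
  case (Suc k)
  have M: "prob_space M" and step: "\<And>t x y. y \<in> S \<Longrightarrow> \<P>(\<omega> in M. \<forall>s\<le>t. X s \<omega> = x s) > 0 \<Longrightarrow>
        \<P>(\<omega> in M. X (Suc t) \<omega> = y \<bar> \<forall>s\<le>t. X s \<omega> = x s) = p (x t) y"
    and X: "\<And>t. X t \<in> M \<rightarrow>\<^sub>M count_space S"
    using mc unfolding markov_chain_def by auto
  interpret prob_space M by (rule M)
  have [measurable]: "Measurable.pred M (\<lambda>\<omega>. X s \<omega> = c)" "Measurable.pred M (\<lambda>\<omega>. X s \<omega> \<noteq> c)" for s c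
    using markov_chain_pred[OF mc, of "\<lambda>y. y = c" s] markov_chain_pred[OF mc, of "\<lambda>y. y \<noteq> c" s] by auto
  let ?E = "{\<omega> \<in> space M. (\<forall>s\<le>t. X s \<omega> = x s) \<and> (\<forall>s\<le>Suc k. X (t + s) \<omega> \<noteq> b)}"
  show ?case
  proof (cases "x t = b")
    case True
    then have "?E = {}" by auto
    with True show ?thesis by (simp only: measure_empty) simp
  next
    case False
    define E where "E y = {\<omega> \<in> space M. (\<forall>s\<le>Suc t. X s \<omega> = (x(Suc t := y)) s) \<and>
      (\<forall>s\<le>k. X (Suc t + s) \<omega> \<noteq> b)}" for y
    have hist: "(\<forall>s\<le>Suc t. X s \<omega> = (x(Suc t := y)) s) \<longleftrightarrow> (\<forall>s\<le>t. X s \<omega> = x s) \<and> X (Suc t) \<omega> = y" for y \<omega>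
      by (auto simp: le_Suc_eq)
    have "?E = (\<Union>y\<in>S. E y)"
      using measurable_space[OF X] False unfolding E_def hist All_le_Suc2 by auto
    then have "prob ?E = prob (\<Union>y\<in>S. E y)" by simp
    also have "\<dots> = (\<Sum>y\<in>S. prob (E y))"
    proof (rule finite_measure_finite_Union[OF S])
      have "E y \<in> sets M" for y unfolding E_def by measurable
      then show "E ` S \<subseteq> sets M" by blast
      show "disjoint_family_on E S" unfolding E_def hist disjoint_family_on_def by blast
    qed
    also have "\<dots> = (\<Sum>y\<in>S. prob {\<omega> \<in> space M. \<forall>s\<le>t. X s \<omega> = x s} * (p (x t) y * killed S p b (\<lambda>_. 1) k y))"
    proof (rule sum.cong[OF refl])
      fix y assume y: "y \<in> S"
      have le: "prob {\<omega> \<in> space M. X (Suc t) \<omega> = y \<and> (\<forall>s\<le>t. X s \<omega> = x s)} \<le>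
          prob {\<omega> \<in> space M. \<forall>s\<le>t. X s \<omega> = x s}"
        by (intro finite_measure_mono) auto
      have "prob {\<omega> \<in> space M. \<forall>s\<le>Suc t. X s \<omega> = (x(Suc t := y)) s} =
          prob {\<omega> \<in> space M. X (Suc t) \<omega> = y \<and> (\<forall>s\<le>t. X s \<omega> = x s)}"
        unfolding hist by (simp only: conj_commute)
      also have "\<dots> = prob {\<omega> \<in> space M. \<forall>s\<le>t. X s \<omega> = x s} * p (x t) y"
      proof (cases "prob {\<omega> \<in> space M. \<forall>s\<le>t. X s \<omega> = x s} > 0")
        case True
        from step[OF y this] True show ?thesis
          unfolding cond_prob_def by (simp add: divide_eq_eq mult.commute)
      next
        case False
        \<comment> \<open>The Markov property is silent on histories of probability 0, but then the
          longer history has probability 0 too.\<close>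
        then have "prob {\<omega> \<in> space M. \<forall>s\<le>t. X s \<omega> = x s} = 0"
          by (simp add: zero_less_measure_iff)
        then show ?thesis
          using le measure_nonneg[of M "{\<omega> \<in> space M. X (Suc t) \<omega> = y \<and> (\<forall>s\<le>t. X s \<omega> = x s)}"]
          by simp
      qed
      finally show "prob (E y) =
          prob {\<omega> \<in> space M. \<forall>s\<le>t. X s \<omega> = x s} * (p (x t) y * killed S p b (\<lambda>_. 1) k y)"
        unfolding E_def using Suc.IH[of "x(Suc t := y)" "Suc t"] y by simp
    qed
    finally show ?thesis using False by (simp add: sum_distrib_left)
  qed
qed

text \<open>A natural number is the number of \<open>k\<close> below it, and \<open>k\<close> is
  below the hitting time iff \<open>b\<close> is avoided up to time \<open>k\<close>. On a path that
  never meets \<open>b\<close>, the infimum of the empty set and the series of ones are both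
  \<open>top\<close>.\<close>

lemma hitting_time_eq_suminf: "hitting_time X b \<omega> = (\<Sum>k. of_bool (\<forall>s\<le>k. X s \<omega> \<noteq> b))"
proof (cases "\<exists>t. X t \<omega> = b")
  case True
  define T where "T = (LEAST t. X t \<omega> = b)"
  have T: "X T \<omega> = b" unfolding T_def using True by (rule LeastI_ex)
  have T_le: "T \<le> t" if "X t \<omega> = b" for t unfolding T_def using that by (rule Least_le)
  have "hitting_time X b \<omega> = of_nat T"
    unfolding hitting_time_def
    by (intro antisym INF_lower2[of T] INF_greatest) (use T T_le in auto)
  moreover have "(\<Sum>k. of_bool (\<forall>s\<le>k. X s \<omega> \<noteq> b)) = (\<Sum>k<T. 1 :: ennreal)"
  proof (subst suminf_finite[of "{..<T}"])
    show "of_bool (\<forall>s\<le>k. X s \<omega> \<noteq> b) = (0 :: ennreal)" if "k \<notin> {..<T}" for k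
      using that T by (auto intro!: exI[of _ T])
    show "(\<Sum>k<T. of_bool (\<forall>s\<le>k. X s \<omega> \<noteq> b)) = (\<Sum>k<T. 1 :: ennreal)"
      using T_le by (intro sum.cong) (auto simp: not_le[symmetric] dest: le_trans)
  qed simp
  ultimately show ?thesis by simp
next
  case False
  have "of_nat n \<le> (\<Sum>k. 1 :: ennreal)" for n
    using sum_le_suminf[of "\<lambda>_. 1 :: ennreal" "{..<n}"] by simp
  then have "(\<Sum>k. 1 :: ennreal) = top"
    using ennreal_Ex_less_of_nat[of "\<Sum>k. 1 :: ennreal"] by (meson leD top.not_eq_extremum)
  then show ?thesis unfolding hitting_time_def using False by simp
qed

text \<open>Integrating the tail sum of the hitting time term by term gives the series of avoidance
  probabilities, and its sum has been identified as \<open>g a\<close>.\<close>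

lemma enn2ereal_hitting_matrix_eq:
  assumes mc: "markov_chain S p M X" and S: "finite S"
    and p: "\<And>a c. a \<in> S \<Longrightarrow> c \<in> S \<Longrightarrow> 0 \<le> p a c"
    and sum1: "\<And>a. a \<in> S \<Longrightarrow> (\<Sum>c\<in>S. p a c) = 1"
    and g: "g b = 0" "\<And>a. a \<in> S \<Longrightarrow> a \<noteq> b \<Longrightarrow> g a = 1 + (\<Sum>c\<in>S. p a c * g c)" and a: "a \<in> S"
  shows "enn2ereal (hitting_matrix M X a b) = ereal (g a)"
proof -
  have M: "prob_space M" and pos: "\<P>(\<omega> in M. X 0 \<omega> = a) > 0"
    using mc a unfolding markov_chain_def by auto
  interpret prob_space M by (rule M)
  have [measurable]: "Measurable.pred M (\<lambda>\<omega>. X s \<omega> = c)" "Measurable.pred M (\<lambda>\<omega>. X s \<omega> \<noteq> c)" for s c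
    using markov_chain_pred[OF mc, of "\<lambda>y. y = c" s] markov_chain_pred[OF mc, of "\<lambda>y. y \<noteq> c" s] by auto
  define A where "A = {\<omega> \<in> space M. X 0 \<omega> = a}"
  define V where "V k = {\<omega> \<in> space M. \<forall>s\<le>k. X s \<omega> \<noteq> b}" for k
  have [measurable]: "A \<in> sets M" "V k \<in> sets M" for k unfolding A_def V_def by measurable
  let ?u = "\<lambda>k. killed S p b (\<lambda>_. 1) k a"
  have u: "emeasure (uniform_measure M A) (V k) = ennreal (?u k)" for k
  proof -
    have "prob (A \<inter> V k) = prob A * ?u k"
      using markov_chain_prob_avoid[OF mc S, of "\<lambda>_. a" 0 k b] a
      by (simp add: A_def V_def Int_def conj_ac cong: conj_cong)
    then have "emeasure (uniform_measure M A) (V k) = ennreal (prob A * ?u k) / ennreal (prob A)"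
      by (simp add: emeasure_eq_measure)
    then show ?thesis
      using pos by (simp add: A_def divide_ennreal killed_one_nonneg[OF p a] del: killed.simps)
  qed
  have "hitting_matrix M X a b = (\<integral>\<^sup>+ \<omega>. (\<Sum>k. indicator (V k) \<omega>) \<partial>uniform_measure M A)"
    unfolding hitting_matrix_def A_def[symmetric] hitting_time_eq_suminf
    by (intro nn_integral_cong suminf_cong) (auto simp: V_def indicator_def)
  also have "\<dots> = (\<Sum>k. ennreal (?u k))"
    by (subst nn_integral_suminf) (auto simp: u simp del: killed.simps)
  also have "\<dots> = ennreal (g a)"
    using killed_one_sums[where g = g, OF S p sum1 g a]
    by (intro suminf_ennreal_eq) (auto intro: killed_one_nonneg p a)
  \<comment> \<open>\<open>ennreal\<close> sends negative reals to 0, so passing to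
    \<open>ereal\<close> needs \<open>0 \<le> g a\<close>; this holds because \<open>g a\<close> is
    the sum of a series of nonnegative terms.\<close>
  finally show ?thesis
    using sums_le[OF _ sums_zero killed_one_sums[where g = g, OF S p sum1 g a]]
      killed_one_nonneg[where S = S and p = p, OF p a] by simp
qed

text \<open>Maximum principle: where the modulus of \<open>g\<close> is largest, at
  \<open>m\<close>, the value \<open>g m\<close> equals its killed expectation at time
  \<open>t\<close>, so its modulus is at most itself times the probability of avoiding
  \<open>b\<close> up to \<open>t\<close>. Irreducibility yields a \<open>t\<close> for which this
  probability is below 1.\<close>

lemma harmonic_eq_zero:
  assumes mc: "markov_chain S p M X" and irr: "irreducible_chain S M X" and S: "finite S"
    and p: "\<And>a c. a \<in> S \<Longrightarrow> c \<in> S \<Longrightarrow> 0 \<le> p a c" and b: "b \<in> S"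
    and g: "g b = 0" "\<And>a. a \<in> S \<Longrightarrow> a \<noteq> b \<Longrightarrow> g a = (\<Sum>c\<in>S. p a c * g c)" and a: "a \<in> S"
  shows "g a = 0"
proof -
  have M: "prob_space M" and pos: "\<And>a. a \<in> S \<Longrightarrow> \<P>(\<omega> in M. X 0 \<omega> = a) > 0"
    using mc unfolding markov_chain_def by auto
  interpret prob_space M by (rule M)
  have [measurable]: "Measurable.pred M (\<lambda>\<omega>. X s \<omega> = c)" "Measurable.pred M (\<lambda>\<omega>. X s \<omega> \<noteq> c)" for s c
    using markov_chain_pred[OF mc, of "\<lambda>y. y = c" s] markov_chain_pred[OF mc, of "\<lambda>y. y \<noteq> c" s] by auto
  obtain m where m: "m \<in> S" and max: "\<And>c. c \<in> S \<Longrightarrow> \<bar>g c\<bar> \<le> \<bar>g m\<bar>"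
  proof -
    define C where "C = Max ((\<lambda>c. \<bar>g c\<bar>) ` S)"
    have "C \<in> (\<lambda>c. \<bar>g c\<bar>) ` S" unfolding C_def using S a by (intro Max_in) auto
    moreover have "\<bar>g c\<bar> \<le> C" if "c \<in> S" for c unfolding C_def using S that by simp
    ultimately show ?thesis using that by auto
  qed
  obtain t where "\<P>(\<omega> in M. X t \<omega> = b \<bar> X 0 \<omega> = m) > 0"
    using irr m b unfolding irreducible_chain_def by blast
  then have hit: "prob {\<omega> \<in> space M. X t \<omega> = b \<and> X 0 \<omega> = m} > 0"
    using measure_nonneg by (auto simp: cond_prob_def zero_less_divide_iff not_less[symmetric])
  let ?u = "killed S p b (\<lambda>_. 1) t m"
  have "prob {\<omega> \<in> space M. X 0 \<omega> = m} * ?u = prob {\<omega> \<in> space M. X 0 \<omega> = m \<and> (\<forall>s\<le>t. X s \<omega> \<noteq> b)}"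
    using markov_chain_prob_avoid[OF mc S, of "\<lambda>_. m" 0 t b] m by (simp cong: conj_cong)
  moreover have "prob {\<omega> \<in> space M. X 0 \<omega> = m \<and> (\<forall>s\<le>t. X s \<omega> \<noteq> b)} +
      prob {\<omega> \<in> space M. X t \<omega> = b \<and> X 0 \<omega> = m} \<le> prob {\<omega> \<in> space M. X 0 \<omega> = m}"
    by (subst finite_measure_Union[symmetric]) (auto intro!: finite_measure_mono)
  ultimately have "prob {\<omega> \<in> space M. X 0 \<omega> = m} * ?u < prob {\<omega> \<in> space M. X 0 \<omega> = m} * 1"
    using hit by linarith
  then have u: "?u < 1" using pos[OF m] by (simp only: mult_less_cancel_left_pos)
  have "g m = killed S p b g t m"
    using killed_telescope[where g = g and \<theta> = 0 and t = t and p = p and S = S and b = b, OF g(1) _ m] g(2) by simp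
  moreover have "\<bar>killed S p b g t m\<bar> \<le> \<bar>g m\<bar> * ?u"
    by (rule abs_killed_le) (use p max m in auto)
  ultimately have "\<bar>g m\<bar> * (1 - ?u) \<le> 0" by (simp add: algebra_simps)
  then have "\<bar>g m\<bar> = 0" using u by (smt (verit) mult_pos_pos)
  then show ?thesis using max[OF a] by simp
qed

section \<open>Invariant sums over injections\<close>

lemma finite_FI: "finite (FI m n)"
  unfolding FI_def by (rule finite_subset[of _ "{1..m} \<rightarrow>\<^sub>E {1..n}"]) (auto intro: finite_PiE)

lemma FI_mono: "m \<le> n \<Longrightarrow> FI d m \<subseteq> FI d n"
  unfolding FI_def PiE_def by fastforce

lemma FI_bij_betw: "\<sigma> \<in> FI n n \<Longrightarrow> bij_betw \<sigma> {1..n} {1..n}"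
  unfolding FI_def bij_betw_def using endo_inj_surj[of "{1..n}" \<sigma>] by blast

lemma FI_apply: "f \<in> FI m n \<Longrightarrow> i \<in> {1..m} \<Longrightarrow> f i \<in> {1..n}"
  unfolding FI_def by blast

lemma FI_eqI:
  assumes "f \<in> FI m n" "g \<in> FI m n'" "\<And>i. i \<in> {1..m} \<Longrightarrow> f i = g i"
  shows "f = g"
proof (rule extensionalityI)
  show "f \<in> extensional {1..m}" "g \<in> extensional {1..m}"
    using assms(1,2) unfolding FI_def PiE_def by blast+
qed (rule assms(3))

lemma FI_fun_upd:
  assumes "g \<in> FI d n" "v \<in> {1..n} - g ` {1..d}"
  shows "g(Suc d := v) \<in> FI (Suc d) n"
proof -
  have Suc_eq: "{1..Suc d} = insert (Suc d) {1..d}" by auto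
  have "g(Suc d := v) \<in> insert (Suc d) {1..d} \<rightarrow>\<^sub>E {1..n}"
    using assms unfolding FI_def by (intro PiE_fun_upd) blast+
  moreover have "g(Suc d := v) ` {1..d} = g ` {1..d}" by (intro image_cong) auto
  moreover have "inj_on (g(Suc d := v)) {1..d}"
    using assms unfolding FI_def by (intro inj_on_fun_updI) auto
  ultimately show ?thesis
    using assms unfolding FI_def Suc_eq by simp
qed

lemma restrict_FI_fun_upd: "g \<in> FI d n \<Longrightarrow> restrict (g(Suc d := v)) {1..d} = g"
  unfolding FI_def by (auto simp: fun_eq_iff PiE_def extensional_def)

lemma sum_FI_Suc:
  "(\<Sum>f\<in>FI (Suc d) n. \<phi> f) = (\<Sum>g\<in>FI d n. \<Sum>v\<in>{1..n} - g ` {1..d}. \<phi> (g(Suc d := v)))"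
proof -
  have ran: "f i \<in> {1..n}" if "f \<in> FI (Suc d) n" "i \<in> {1..Suc d}" for f i
    using that unfolding FI_def by blast
  have "(\<Sum>f\<in>FI (Suc d) n. \<phi> f) =
    (\<Sum>(g, v)\<in>(SIGMA g:FI d n. {1..n} - g ` {1..d}). \<phi> (g(Suc d := v)))"
  proof (rule sum.reindex_bij_witness[of _ "\<lambda>(g, v). g(Suc d := v)"
        "\<lambda>f. (restrict f {1..d}, f (Suc d))"])
    fix f assume f: "f \<in> FI (Suc d) n"
    have inj: "inj_on f {1..Suc d}" and ext: "f \<in> extensional {1..Suc d}"
      using f unfolding FI_def PiE_def by auto
    have upd: "(restrict f {1..d})(Suc d := f (Suc d)) = f"
      using ext by (auto simp: fun_eq_iff extensional_def)
    then show "(case (restrict f {1..d}, f (Suc d)) of (g, v) \<Rightarrow> g(Suc d := v)) = f"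
      and "(case (restrict f {1..d}, f (Suc d)) of (g, v) \<Rightarrow> \<phi> (g(Suc d := v))) = \<phi> f" by simp_all
    have "inj_on f {1..d}" using inj by (rule inj_on_subset) auto
    moreover have "restrict f {1..d} \<in> {1..d} \<rightarrow>\<^sub>E {1..n}"
      by (rule restrict_PiE_iff[THEN iffD2]) (intro ballI ran[OF f], simp)
    ultimately have "restrict f {1..d} \<in> FI d n"
      unfolding FI_def by (simp add: inj_on_restrict_eq del: One_nat_def)
    moreover have "f (Suc d) \<notin> f ` {1..d}"
      by (auto dest!: inj_onD[OF inj])
    ultimately show "(restrict f {1..d}, f (Suc d)) \<in> (SIGMA g:FI d n. {1..n} - g ` {1..d})"
      using ran[OF f, of "Suc d"] by simp
  next
    fix x assume "x \<in> (SIGMA g:FI d n. {1..n} - g ` {1..d})"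
    then obtain g v where x: "x = (g, v)" and g: "g \<in> FI d n" and v: "v \<in> {1..n} - g ` {1..d}"
      by blast
    show "(restrict (case x of (g, v) \<Rightarrow> g(Suc d := v)) {1..d},
        (case x of (g, v) \<Rightarrow> g(Suc d := v)) (Suc d)) = x"
      unfolding x using restrict_FI_fun_upd[OF g, of v] by simp
    show "(case x of (g, v) \<Rightarrow> g(Suc d := v)) \<in> FI (Suc d) n"
      unfolding x using FI_fun_upd[OF g v] by simp
  qed
  also have "\<dots> = (\<Sum>g\<in>FI d n. \<Sum>v\<in>{1..n} - g ` {1..d}. \<phi> (g(Suc d := v)))"
    by (rule sum.Sigma[symmetric]) (auto simp: finite_FI)
  finally show ?thesis .
qed

lemma compose_fun_upd:
  "compose {1..Suc d} \<sigma> (g(Suc d := v)) = (compose {1..d} \<sigma> g)(Suc d := \<sigma> v)"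
  by (auto simp: compose_def fun_eq_iff)

lemma transpose_FI:
  assumes "i \<in> {1..n}" "j \<in> {1..n}"
  shows "(\<lambda>k\<in>{1..n}. Transposition.transpose i j k) \<in> FI n n"
  using assms unfolding FI_def
  by (simp add: inj_on_restrict_eq restrict_PiE_iff) (simp add: Transposition.transpose_def)

text \<open>A value added to an injection into \<open>{1..m + d}\<close> is either at most \<open>m + d\<close> or one of the
  \<open>n - m - d\<close> larger ones, which transpositions fixing \<open>{1..m + d}\<close> identify with \<open>m + d + 1\<close>.\<close>

lemma sum_FI_eq_sum_poly:
  "\<exists>c :: (nat \<Rightarrow> nat) \<Rightarrow> real poly. \<forall>n\<ge>m + d. \<forall>\<phi> :: (nat \<Rightarrow> nat) \<Rightarrow> real.
     (\<forall>f\<in>FI d n. \<forall>\<sigma>\<in>FI n n. (\<forall>i\<in>{1..m}. \<sigma> i = i) \<longrightarrow> \<phi> (compose {1..d} \<sigma> f) = \<phi> f) \<longrightarrow>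
     (\<Sum>f\<in>FI d n. \<phi> f) = (\<Sum>f\<in>FI d (m + d). poly (c f) (real n) * \<phi> f)"
proof (induction d)
  case 0
  have "FI 0 n = {\<lambda>_. undefined}" for n unfolding FI_def by auto
  then show ?case by (intro exI[of _ "\<lambda>_. 1"]) simp
next
  case (Suc d)
  then obtain c :: "(nat \<Rightarrow> nat) \<Rightarrow> real poly" where c': "\<forall>n\<ge>m + d. \<forall>\<phi> :: (nat \<Rightarrow> nat) \<Rightarrow> real.
     (\<forall>f\<in>FI d n. \<forall>\<sigma>\<in>FI n n. (\<forall>i\<in>{1..m}. \<sigma> i = i) \<longrightarrow> \<phi> (compose {1..d} \<sigma> f) = \<phi> f) \<longrightarrow>
     (\<Sum>f\<in>FI d n. \<phi> f) = (\<Sum>f\<in>FI d (m + d). poly (c f) (real n) * \<phi> f)"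
    by (rule exE)
  have c: "(\<Sum>f\<in>FI d n. \<phi> f) = (\<Sum>f\<in>FI d (m + d). poly (c f) (real n) * \<phi> f)"
    if "m + d \<le> n" and inv: "\<And>f \<sigma>. f \<in> FI d n \<Longrightarrow> \<sigma> \<in> FI n n \<Longrightarrow>
      (\<And>i. i \<in> {1..m} \<Longrightarrow> \<sigma> i = i) \<Longrightarrow> \<phi> (compose {1..d} \<sigma> f) = \<phi> f" for n \<phi>
    by (rule c'[rule_format, OF that(1)]) (rule inv, auto)
  define wt :: "nat \<Rightarrow> real poly" where
    "wt v = (if v = Suc (m + d) then [:- real (m + d), 1:] else 1)" for v
  \<comment> \<open>\<open>FI (Suc d) (m + Suc d)\<close> also contains injections that take the
    value \<open>m + Suc d\<close> among their first \<open>d\<close> values. They represent no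
    class and get coefficient 0, so that the sum may run over the whole set.\<close>
  define c' where "c' f = (if restrict f {1..d} \<in> FI d (m + d)
    then c (restrict f {1..d}) * wt (f (Suc d)) else 0)" for f
  have key: "(\<Sum>f\<in>FI (Suc d) n. \<phi> f) =
      (\<Sum>f\<in>FI (Suc d) (m + Suc d). poly (c' f) (real n) * \<phi> f)"
    if n: "m + Suc d \<le> n" and inv: "\<And>f \<sigma>. f \<in> FI (Suc d) n \<Longrightarrow> \<sigma> \<in> FI n n \<Longrightarrow>
        (\<And>i. i \<in> {1..m} \<Longrightarrow> \<sigma> i = i) \<Longrightarrow> \<phi> (compose {1..Suc d} \<sigma> f) = \<phi> f" for n \<phi>
  proof -
    \<comment> \<open>The last value is summed out. The result is again invariant, because \<sigma>
      maps the complement of the image of \<open>g\<close> onto the complement of the image of the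
      composite; hence the induction hypothesis applies to it.\<close>
    define \<phi>' where "\<phi>' g = (\<Sum>v\<in>{1..n} - g ` {1..d}. \<phi> (g(Suc d := v)))" for g
    have "(\<Sum>f\<in>FI (Suc d) n. \<phi> f) = (\<Sum>g\<in>FI d n. \<phi>' g)"
      unfolding sum_FI_Suc \<phi>'_def ..
    also have "\<dots> = (\<Sum>g\<in>FI d (m + d). poly (c g) (real n) * \<phi>' g)"
    proof (rule c)
      fix g \<sigma> assume g: "g \<in> FI d n" and \<sigma>: "\<sigma> \<in> FI n n" and fix_m: "\<And>i. i \<in> {1..m} \<Longrightarrow> \<sigma> i = i"
      have b: "bij_betw \<sigma> {1..n} {1..n}" by (rule FI_bij_betw[OF \<sigma>])
      have gn: "g ` {1..d} \<subseteq> {1..n}" using g unfolding FI_def by auto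
      have im: "compose {1..d} \<sigma> g ` {1..d} = \<sigma> ` (g ` {1..d})"
        by (auto simp: compose_def image_image)
      have "bij_betw \<sigma> ({1..n} - g ` {1..d}) ({1..n} - \<sigma> ` (g ` {1..d}))"
        using b gn inj_on_image_set_diff[of \<sigma> "{1..n}" "{1..n}" "g ` {1..d}"]
        unfolding bij_betw_def by (simp add: inj_on_diff)
      then have "\<phi>' (compose {1..d} \<sigma> g) =
        (\<Sum>v\<in>{1..n} - g ` {1..d}. \<phi> ((compose {1..d} \<sigma> g)(Suc d := \<sigma> v)))"
        unfolding \<phi>'_def im by (rule sum.reindex_bij_betw[symmetric])
      also have "\<dots> = \<phi>' g"
        unfolding \<phi>'_def
      proof (rule sum.cong[OF refl])
        fix v assume "v \<in> {1..n} - g ` {1..d}"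
        from inv[OF FI_fun_upd[OF g this] \<sigma> fix_m]
        show "\<phi> ((compose {1..d} \<sigma> g)(Suc d := \<sigma> v)) = \<phi> (g(Suc d := v))"
          unfolding compose_fun_upd by simp
      qed
      finally show "\<phi>' (compose {1..d} \<sigma> g) = \<phi>' g" .
    qed (use n in simp)
    also have "\<dots> = (\<Sum>g\<in>FI d (m + d). \<Sum>v\<in>{1..m + Suc d} - g ` {1..d}.
        poly (c' (g(Suc d := v))) (real n) * \<phi> (g(Suc d := v)))"
    proof (rule sum.cong[OF refl])
      fix g assume g: "g \<in> FI d (m + d)"
      have gn: "g \<in> FI d n" using g FI_mono[of "m + d" n d] n by auto
      have gd: "g ` {1..d} \<subseteq> {1..m + d}" using g unfolding FI_def by auto
      let ?l = "Suc (m + d)"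
      have same: "\<phi> (g(Suc d := v)) = \<phi> (g(Suc d := ?l))" if v: "v \<in> {?l..n}" for v
      proof -
        let ?\<sigma> = "\<lambda>k\<in>{1..n}. Transposition.transpose v ?l k"
        have \<sigma>: "?\<sigma> \<in> FI n n" by (rule transpose_FI) (use v n in auto)
        have "g(Suc d := ?l) \<in> FI (Suc d) n" by (rule FI_fun_upd[OF gn]) (use gd n in auto)
        from inv[OF this \<sigma>]
        have "\<phi> (compose {1..Suc d} ?\<sigma> (g(Suc d := ?l))) = \<phi> (g(Suc d := ?l))"
          using v n by (auto simp: Transposition.transpose_def)
        also have "compose {1..d} ?\<sigma> g = g"
        proof (rule FI_eqI[OF FI_comp[OF gn \<sigma>] gn])
          fix i assume i: "i \<in> {1..d}"
          then have "g i \<in> {1..m + d}" using gd by blast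
          then show "compose {1..d} ?\<sigma> g i = g i"
            using i v n by (auto simp: compose_def Transposition.transpose_def)
        qed
        then have "compose {1..Suc d} ?\<sigma> (g(Suc d := ?l)) = g(Suc d := v)"
          unfolding compose_fun_upd using n by simp
        finally show ?thesis .
      qed
      have res: "restrict (g(Suc d := v)) {1..d} = g" for v
        by (rule restrict_FI_fun_upd[OF g])
      have c'g: "c' (g(Suc d := v)) = c g * wt v" for v
        unfolding c'_def res using g by simp
      have "{1..n} - g ` {1..d} = ({1..m + d} - g ` {1..d}) \<union> {?l..n}"
        using gd n by auto
      then have "\<phi>' g = (\<Sum>v\<in>{1..m + d} - g ` {1..d}. \<phi> (g(Suc d := v))) + (\<Sum>v\<in>{?l..n}. \<phi> (g(Suc d := v)))"
        unfolding \<phi>'_def by (simp only:) (intro sum.union_disjoint; auto)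
      also have "(\<Sum>v\<in>{?l..n}. \<phi> (g(Suc d := v))) = poly (wt ?l) (real n) * \<phi> (g(Suc d := ?l))"
      proof -
        have "(\<Sum>v\<in>{?l..n}. \<phi> (g(Suc d := v))) = (\<Sum>v\<in>{?l..n}. \<phi> (g(Suc d := ?l)))"
          by (rule sum.cong[OF refl same])
        then show ?thesis using n by (simp add: wt_def of_nat_diff algebra_simps)
      qed
      also have "(\<Sum>v\<in>{1..m + d} - g ` {1..d}. \<phi> (g(Suc d := v))) =
          (\<Sum>v\<in>{1..m + d} - g ` {1..d}. poly (wt v) (real n) * \<phi> (g(Suc d := v)))"
        by (rule sum.cong) (auto simp: wt_def)
      also have "\<dots> + poly (wt ?l) (real n) * \<phi> (g(Suc d := ?l)) =
          (\<Sum>v\<in>insert ?l ({1..m + d} - g ` {1..d}). poly (wt v) (real n) * \<phi> (g(Suc d := v)))"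
        by (subst sum.insert) auto
      also have "insert ?l ({1..m + d} - g ` {1..d}) = {1..m + Suc d} - g ` {1..d}"
        using gd by auto
      finally show "poly (c g) (real n) * \<phi>' g = (\<Sum>v\<in>{1..m + Suc d} - g ` {1..d}.
          poly (c' (g(Suc d := v))) (real n) * \<phi> (g(Suc d := v)))"
        by (simp only: c'g poly_mult sum_distrib_left mult.assoc)
    qed
    also have "\<dots> = (\<Sum>g\<in>FI d (m + Suc d). \<Sum>v\<in>{1..m + Suc d} - g ` {1..d}.
        poly (c' (g(Suc d := v))) (real n) * \<phi> (g(Suc d := v)))"
    proof (rule sum.mono_neutral_left, rule finite_FI, rule FI_mono, simp, rule ballI)
      fix g assume g: "g \<in> FI d (m + Suc d) - FI d (m + d)"
      then have res: "restrict (g(Suc d := v)) {1..d} = g" for v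
        using restrict_FI_fun_upd[of g d "m + Suc d" v] by simp
      show "(\<Sum>v\<in>{1..m + Suc d} - g ` {1..d}.
        poly (c' (g(Suc d := v))) (real n) * \<phi> (g(Suc d := v))) = 0"
        unfolding c'_def res using g by simp
    qed
    also have "\<dots> = (\<Sum>f\<in>FI (Suc d) (m + Suc d). poly (c' f) (real n) * \<phi> f)"
      by (rule sum_FI_Suc[symmetric])
    finally show ?thesis .
  qed
  show ?case
  proof (intro exI[of _ c'] allI impI)
    fix n and \<phi> :: "(nat \<Rightarrow> nat) \<Rightarrow> real"
    assume n: "m + Suc d \<le> n" and inv: "\<forall>f\<in>FI (Suc d) n. \<forall>\<sigma>\<in>FI n n.
      (\<forall>i\<in>{1..m}. \<sigma> i = i) \<longrightarrow> \<phi> (compose {1..Suc d} \<sigma> f) = \<phi> f"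
    show "(\<Sum>f\<in>FI (Suc d) n. \<phi> f) =
        (\<Sum>f\<in>FI (Suc d) (m + Suc d). poly (c' f) (real n) * \<phi> f)"
      by (rule key[OF n]) (rule inv[rule_format])
  qed
qed

section \<open>Counting in finitely generated FI-sets\<close>

text \<open>Singling out the standard inclusion makes one element at one level determine a coherent
  family at all later levels; statements about large \<open>n\<close> are made along such
  families.\<close>

definition extend :: "'a fi_set \<Rightarrow> nat \<Rightarrow> nat \<Rightarrow> 'a \<Rightarrow> 'a" where
  "extend Z m n x = mor Z m n (\<lambda>i\<in>{1..m}. i) x"

lemma extend_in: "is_fi_set Z \<Longrightarrow> m \<le> n \<Longrightarrow> x \<in> obj Z m \<Longrightarrow> extend Z m n x \<in> obj Z n"
  unfolding extend_def by (rule mor_in[OF _ FI_inclusion])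

lemma mor_eq_extend_mor:
  assumes "is_fi_set Z" "f \<in> FI d m" "m \<le> n" "y \<in> obj Z d"
  shows "mor Z d n f y = extend Z m n (mor Z d m f y)"
proof -
  have f: "f \<in> FI d n" using assms FI_mono by blast
  have "compose {1..d} (\<lambda>i\<in>{1..m}. i) f = f"
    by (rule FI_eqI[OF FI_comp[OF assms(2) FI_inclusion[OF assms(3)]] f])
      (use FI_apply[OF assms(2)] in \<open>simp add: compose_def\<close>)
  then show ?thesis
    unfolding extend_def using mor_comp[OF assms(1,2) FI_inclusion[OF assms(3)] assms(4)] by simp
qed

lemma extend_extend:
  assumes "is_fi_set Z" "l \<le> m" "m \<le> n" "x \<in> obj Z l"
  shows "extend Z m n (extend Z l m x) = extend Z l n x"
  using mor_eq_extend_mor[OF assms(1) FI_inclusion[OF assms(2)] assms(3,4)]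
  unfolding extend_def[of Z l] by simp

lemma mor_extend_fixed:
  assumes "is_fi_set Z" "m \<le> n" "x \<in> obj Z m" "\<sigma> \<in> FI n n" "\<And>i. i \<in> {1..m} \<Longrightarrow> \<sigma> i = i"
  shows "mor Z n n \<sigma> (extend Z m n x) = extend Z m n x"
proof -
  have "compose {1..m} \<sigma> (\<lambda>i\<in>{1..m}. i) = (\<lambda>i\<in>{1..m}. i)"
    using assms(5) by (simp add: compose_def cong: restrict_cong)
  then show ?thesis
    unfolding extend_def using mor_comp[OF assms(1) FI_inclusion[OF assms(2)] assms(4,3)] by simp
qed

lemma mor_bij_betw:
  assumes Z: "is_fi_set Z" and \<sigma>: "\<sigma> \<in> FI n n"
  shows "bij_betw (mor Z n n \<sigma>) (obj Z n) (obj Z n)"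
proof -
  have "(\<lambda>i\<in>{1..n}. i) \<in> FI n n" by (rule FI_inclusion) simp
  from FI_transitive[OF this \<sigma>] obtain \<tau> where \<tau>: "\<tau> \<in> FI n n"
    and *: "(\<lambda>i\<in>{1..n}. i) = compose {1..n} \<tau> \<sigma>" by blast
  have "mor Z n n \<tau> (mor Z n n \<sigma> x) = x" if "x \<in> obj Z n" for x
    using mor_comp[OF Z \<sigma> \<tau> that] Z that unfolding is_fi_set_def by (metis *)
  then have "inj_on (mor Z n n \<sigma>) (obj Z n)" by (metis inj_on_inverseI)
  moreover have "mor Z n n \<sigma> ` obj Z n \<subseteq> obj Z n" using mor_in[OF Z \<sigma>] by blast
  moreover have "finite (obj Z n)" using Z unfolding is_fi_set_def by blast
  ultimately show ?thesis unfolding bij_betw_def using endo_inj_surj by blast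
qed

lemma FI_compose_bij_betw:
  assumes \<sigma>: "\<sigma> \<in> FI n n"
  shows "bij_betw (compose {1..d} \<sigma>) (FI d n) (FI d n)"
proof -
  have "inj_on (compose {1..d} \<sigma>) (FI d n)"
  proof (rule inj_onI)
    fix f g assume f: "f \<in> FI d n" and g: "g \<in> FI d n"
      and eq: "compose {1..d} \<sigma> f = compose {1..d} \<sigma> g"
    show "f = g"
    proof (rule FI_eqI[OF f g])
      fix i assume i: "i \<in> {1..d}"
      have "\<sigma> (f i) = \<sigma> (g i)" using fun_cong[OF eq, of i] i by (simp add: compose_def)
      then show "f i = g i"
        using inj_onD[OF bij_betw_imp_inj_on[OF FI_bij_betw[OF \<sigma>]]] FI_apply[OF f i] FI_apply[OF g i]
        by blast
    qed
  qed
  moreover have "compose {1..d} \<sigma> ` FI d n \<subseteq> FI d n" using FI_comp[OF _ \<sigma>] by blast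
  ultimately show ?thesis unfolding bij_betw_def using endo_inj_surj[OF finite_FI] by blast
qed

section \<open>Sums over elements in terms of generators\<close>

text \<open>Dividing by this multiplicity turns sums over \<open>obj Z n\<close> into sums over \<open>FI d n\<close>.\<close>

definition multiplicity_gen :: "'a fi_set \<Rightarrow> nat \<Rightarrow> nat \<Rightarrow> 'a \<Rightarrow> real" where
  "multiplicity_gen Z d n x = (\<Sum>y\<in>obj Z d. \<Sum>f\<in>FI d n. of_bool (mor Z d n f y = x))"

lemma finite_obj: "is_fi_set Z \<Longrightarrow> finite (obj Z n)"
  unfolding is_fi_set_def by blast

lemma multiplicity_gen_pos:
  assumes Z: "is_fi_set Z" and ex: "\<exists>f\<in>FI d n. \<exists>y\<in>obj Z d. x = mor Z d n f y"
  shows "0 < multiplicity_gen Z d n x"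
proof -
  obtain f y where f: "f \<in> FI d n" and y: "y \<in> obj Z d" and x: "x = mor Z d n f y"
    using ex by blast
  have "0 < (\<Sum>f\<in>FI d n. of_bool (mor Z d n f y = x) :: real)"
    by (rule sum_pos2[OF finite_FI f]) (simp_all add: x)
  then show ?thesis
    unfolding multiplicity_gen_def by (intro sum_pos2[OF finite_obj[OF Z] y]) (simp_all add: sum_nonneg)
qed

lemma multiplicity_gen_mor:
  assumes Z: "is_fi_set Z" and \<sigma>: "\<sigma> \<in> FI n n" and x: "x \<in> obj Z n"
  shows "multiplicity_gen Z d n (mor Z n n \<sigma> x) = multiplicity_gen Z d n x"
  unfolding multiplicity_gen_def
proof (rule sum.cong[OF refl])
  fix y assume y: "y \<in> obj Z d"
  have "(\<Sum>f\<in>FI d n. of_bool (mor Z d n f y = mor Z n n \<sigma> x) :: real) =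
    (\<Sum>f\<in>FI d n. of_bool (mor Z d n (compose {1..d} \<sigma> f) y = mor Z n n \<sigma> x))"
    by (rule sum.reindex_bij_betw[OF FI_compose_bij_betw[OF \<sigma>], symmetric])
  also have "\<dots> = (\<Sum>f\<in>FI d n. of_bool (mor Z d n f y = x))"
  proof (rule sum.cong[OF refl])
    fix f assume f: "f \<in> FI d n"
    have "mor Z d n (compose {1..d} \<sigma> f) y = mor Z n n \<sigma> x \<longleftrightarrow> mor Z d n f y = x"
      unfolding mor_comp[OF Z f \<sigma> y]
      using inj_on_eq_iff[OF bij_betw_imp_inj_on[OF mor_bij_betw[OF Z \<sigma>]] mor_in[OF Z f y] x] .
    then show "of_bool (mor Z d n (compose {1..d} \<sigma> f) y = mor Z n n \<sigma> x) =
        (of_bool (mor Z d n f y = x) :: real)" by simp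
  qed
  finally show "(\<Sum>f\<in>FI d n. of_bool (mor Z d n f y = mor Z n n \<sigma> x) :: real) =
    (\<Sum>f\<in>FI d n. of_bool (mor Z d n f y = x))" .
qed

lemma sum_obj_eq_sum_gen:
  assumes Z: "is_fi_set Z" and gen: "\<And>x. x \<in> obj Z n \<Longrightarrow> \<exists>f\<in>FI d n. \<exists>y\<in>obj Z d. x = mor Z d n f y"
  shows "(\<Sum>x\<in>obj Z n. \<phi> x) =
    (\<Sum>y\<in>obj Z d. \<Sum>f\<in>FI d n. \<phi> (mor Z d n f y) / multiplicity_gen Z d n (mor Z d n f y))"
    (is "_ = (\<Sum>y\<in>_. \<Sum>f\<in>_. ?\<psi> (mor Z d n f y))")
proof -
  have "(\<Sum>y\<in>obj Z d. \<Sum>f\<in>FI d n. ?\<psi> (mor Z d n f y)) =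
    (\<Sum>y\<in>obj Z d. \<Sum>f\<in>FI d n. \<Sum>x\<in>obj Z n. ?\<psi> x * of_bool (mor Z d n f y = x))"
  proof (intro sum.cong[OF refl])
    fix y f assume "y \<in> obj Z d" "f \<in> FI d n"
    then have "mor Z d n f y \<in> obj Z n" using mor_in[OF Z] by blast
    then show "?\<psi> (mor Z d n f y) = (\<Sum>x\<in>obj Z n. ?\<psi> x * of_bool (mor Z d n f y = x))"
      using finite_obj[OF Z] by (simp add: if_distrib of_bool_def sum.delta cong: if_cong)
  qed
  also have "\<dots> = (\<Sum>x\<in>obj Z n. \<Sum>y\<in>obj Z d. \<Sum>f\<in>FI d n. ?\<psi> x * of_bool (mor Z d n f y = x))"
    by (subst sum.swap[of _ "obj Z d" "obj Z n"], rule sum.cong[OF refl], rule sum.swap)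
  also have "\<dots> = (\<Sum>x\<in>obj Z n. ?\<psi> x * multiplicity_gen Z d n x)"
    unfolding multiplicity_gen_def[of Z d n] by (simp add: sum_distrib_left)
  also have "\<dots> = (\<Sum>x\<in>obj Z n. \<phi> x)"
    using multiplicity_gen_pos[OF Z gen] by (intro sum.cong) fastforce+
  finally show ?thesis ..
qed

text \<open>Permutations fixing \<open>[k]\<close> pointwise fix the extension of \<open>z\<close>,
  so the injections carrying a generator \<open>y\<close> to it are counted by a polynomially
  weighted sum over \<open>FI d (k + d)\<close>. For one such injection the equation, once true,
  stays true, since both sides can be extended.\<close>

lemma eventually_rational_multiplicity_gen:
  assumes Z: "is_fi_set Z" and z: "z \<in> obj Z k"
  shows "eventually_rational (\<lambda>n. multiplicity_gen Z d n (extend Z k n z))"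
  unfolding multiplicity_gen_def
proof (rule eventually_rational_sum)
  fix y assume y: "y \<in> obj Z d"
  obtain c :: "(nat \<Rightarrow> nat) \<Rightarrow> real poly" where
    c: "\<And>n \<phi>. k + d \<le> n \<Longrightarrow> \<forall>f\<in>FI d n. \<forall>\<sigma>\<in>FI n n. (\<forall>i\<in>{1..k}. \<sigma> i = i) \<longrightarrow>
        \<phi> (compose {1..d} \<sigma> f) = \<phi> f \<Longrightarrow>
     (\<Sum>f\<in>FI d n. \<phi> f) = (\<Sum>f\<in>FI d (k + d). poly (c f) (real n) * \<phi> f)"
    using sum_FI_eq_sum_poly[of k d] by (elim exE) blast
  have "(\<Sum>f\<in>FI d n. of_bool (mor Z d n f y = extend Z k n z)) =
      (\<Sum>f\<in>FI d (k + d). poly (c f) (real n) * of_bool (mor Z d n f y = extend Z k n z))"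
    if n: "k + d \<le> n" for n
  proof (rule c[OF n]; intro ballI impI)
    fix f \<sigma> assume f: "f \<in> FI d n" and \<sigma>: "\<sigma> \<in> FI n n" and "\<forall>i\<in>{1..k}. \<sigma> i = i"
    then have fixed: "mor Z n n \<sigma> (extend Z k n z) = extend Z k n z"
      using n by (intro mor_extend_fixed[OF Z _ z]) auto
    have "extend Z k n z \<in> obj Z n" using extend_in[OF Z _ z] n by simp
    then have "mor Z d n (compose {1..d} \<sigma> f) y = extend Z k n z \<longleftrightarrow> mor Z d n f y = extend Z k n z"
      unfolding mor_comp[OF Z f \<sigma> y]
      using inj_on_eq_iff[OF bij_betw_imp_inj_on[OF mor_bij_betw[OF Z \<sigma>]] mor_in[OF Z f y]] fixed
      by metis
    then show "of_bool (mor Z d n (compose {1..d} \<sigma> f) y = extend Z k n z) =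
      (of_bool (mor Z d n f y = extend Z k n z) :: real)" by simp
  qed
  then have eq: "\<forall>\<^sub>F n in sequentially. (\<Sum>f\<in>FI d n. of_bool (mor Z d n f y = extend Z k n z)) =
      (\<Sum>f\<in>FI d (k + d). poly (c f) (real n) * of_bool (mor Z d n f y = extend Z k n z))"
    unfolding eventually_sequentially by blast
  have rat: "eventually_rational (\<lambda>n. of_bool (mor Z d n f y = extend Z k n z))"
    if f: "f \<in> FI d (k + d)" for f
  proof (rule eventually_rational_of_bool_mono[of "k + d"])
    fix n assume n: "k + d \<le> n" and eq: "mor Z d n f y = extend Z k n z"
    have "f \<in> FI d n" using f FI_mono[OF n] by blast
    then have "mor Z d (Suc n) f y = extend Z n (Suc n) (mor Z d n f y)"
      by (rule mor_eq_extend_mor[OF Z _ _ y]) simp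
    then show "mor Z d (Suc n) f y = extend Z k (Suc n) z"
      unfolding eq using extend_extend[OF Z _ _ z, of n "Suc n"] n by simp
  qed
  show "eventually_rational (\<lambda>n. \<Sum>f\<in>FI d n. of_bool (mor Z d n f y = extend Z k n z))"
    by (rule eventually_rational_cong[OF _ eq], rule eventually_rational_sum,
        rule eventually_rational_mult[OF eventually_rational_poly rat])
qed

text \<open>This is an entry of the product of two invariant relations. In terms of generators, the
  summand is a truth value divided by a multiplicity; both are unchanged by permutations fixing
  \<open>[m]\<close>, as these fix the extensions of \<open>a\<close> and \<open>b\<close>. What
  remains is a finite sum of products of polynomials, eventually constant truth values and inverses
  of multiplicities.\<close>

lemma eventually_rational_count:
  assumes Z: "is_fi_set Z" and fg: "finitely_generated Z" and a: "a \<in> obj Z m" and b: "b \<in> obj Z m"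
    and R: "\<And>n \<sigma> x y. N \<le> n \<Longrightarrow> \<sigma> \<in> FI n n \<Longrightarrow> x \<in> obj Z n \<Longrightarrow> y \<in> obj Z n \<Longrightarrow>
        (mor Z n n \<sigma> x, mor Z n n \<sigma> y) \<in> R n \<longleftrightarrow> (x, y) \<in> R n"
    and S: "\<And>n \<sigma> x y. N \<le> n \<Longrightarrow> \<sigma> \<in> FI n n \<Longrightarrow> x \<in> obj Z n \<Longrightarrow> y \<in> obj Z n \<Longrightarrow>
        (mor Z n n \<sigma> x, mor Z n n \<sigma> y) \<in> S n \<longleftrightarrow> (x, y) \<in> S n"
    and R_Suc: "\<And>n x y. N \<le> n \<Longrightarrow> (x, y) \<in> R n \<Longrightarrow>
        (extend Z n (Suc n) x, extend Z n (Suc n) y) \<in> R (Suc n)"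
    and S_Suc: "\<And>n x y. N \<le> n \<Longrightarrow> (x, y) \<in> S n \<Longrightarrow>
        (extend Z n (Suc n) x, extend Z n (Suc n) y) \<in> S (Suc n)"
  shows "eventually_rational
    (\<lambda>n. \<Sum>x\<in>obj Z n. of_bool ((extend Z m n a, x) \<in> R n \<and> (x, extend Z m n b) \<in> S n))"
proof -
  obtain d where d: "\<forall>n\<ge>d. obj Z (Suc n) = (\<Union>f\<in>FI n (Suc n). mor Z n (Suc n) f ` obj Z n)"
    using fg unfolding finitely_generated_def by auto
  obtain c :: "(nat \<Rightarrow> nat) \<Rightarrow> real poly" where
    c: "\<And>n \<phi>. m + d \<le> n \<Longrightarrow> \<forall>f\<in>FI d n. \<forall>\<sigma>\<in>FI n n. (\<forall>i\<in>{1..m}. \<sigma> i = i) \<longrightarrow>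
        \<phi> (compose {1..d} \<sigma> f) = \<phi> f \<Longrightarrow>
     (\<Sum>f\<in>FI d n. \<phi> f) = (\<Sum>f\<in>FI d (m + d). poly (c f) (real n) * \<phi> f)"
    using sum_FI_eq_sum_poly[of m d] by (elim exE) blast
  define T where "T n x \<longleftrightarrow> (extend Z m n a, x) \<in> R n \<and> (x, extend Z m n b) \<in> S n" for n x
  define K where "K = max N (m + d)"
  have "(\<Sum>x\<in>obj Z n. of_bool (T n x)) = (\<Sum>y\<in>obj Z d. \<Sum>f\<in>FI d (m + d). poly (c f) (real n) *
      (of_bool (T n (mor Z d n f y)) * inverse (multiplicity_gen Z d n (mor Z d n f y))))"
    if n: "K \<le> n" for n
  proof -
    have n': "N \<le> n" "m + d \<le> n" "m \<le> n" "d \<le> n" using n unfolding K_def by auto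
    have an: "extend Z m n a \<in> obj Z n" and bn: "extend Z m n b \<in> obj Z n"
      using extend_in[OF Z n'(3)] a b by auto
    have "(\<Sum>x\<in>obj Z n. of_bool (T n x)) = (\<Sum>y\<in>obj Z d. \<Sum>f\<in>FI d n.
      of_bool (T n (mor Z d n f y)) * inverse (multiplicity_gen Z d n (mor Z d n f y)))"
      unfolding divide_inverse[symmetric]
      by (rule sum_obj_eq_sum_gen[OF Z obj_generated[OF Z d n'(4)]])
    also have "\<dots> = (\<Sum>y\<in>obj Z d. \<Sum>f\<in>FI d (m + d). poly (c f) (real n) *
      (of_bool (T n (mor Z d n f y)) * inverse (multiplicity_gen Z d n (mor Z d n f y))))"
    proof (rule sum.cong[OF refl], rule c[OF n'(2)], intro ballI impI)
      fix y f \<sigma> assume y: "y \<in> obj Z d" and f: "f \<in> FI d n" and \<sigma>: "\<sigma> \<in> FI n n"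
        and fixed: "\<forall>i\<in>{1..m}. \<sigma> i = i"
      let ?x = "mor Z d n f y"
      have x: "?x \<in> obj Z n" by (rule mor_in[OF Z f y])
      have fa: "mor Z n n \<sigma> (extend Z m n a) = extend Z m n a"
        by (rule mor_extend_fixed[OF Z n'(3) a \<sigma>]) (use fixed in blast)
      have fb: "mor Z n n \<sigma> (extend Z m n b) = extend Z m n b"
        by (rule mor_extend_fixed[OF Z n'(3) b \<sigma>]) (use fixed in blast)
      have "T n (mor Z n n \<sigma> ?x) \<longleftrightarrow> T n ?x"
        unfolding T_def using R[OF n'(1) \<sigma> an x] S[OF n'(1) \<sigma> x bn] fa fb by simp
      then show "of_bool (T n (mor Z d n (compose {1..d} \<sigma> f) y)) *
          inverse (multiplicity_gen Z d n (mor Z d n (compose {1..d} \<sigma> f) y)) =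
        of_bool (T n ?x) * inverse (multiplicity_gen Z d n ?x)"
        unfolding mor_comp[OF Z f \<sigma> y] multiplicity_gen_mor[OF Z \<sigma> x] by simp
    qed
    finally show ?thesis .
  qed
  then have eq: "\<forall>\<^sub>F n in sequentially. (\<Sum>x\<in>obj Z n. of_bool (T n x)) =
    (\<Sum>y\<in>obj Z d. \<Sum>f\<in>FI d (m + d). poly (c f) (real n) *
      (of_bool (T n (mor Z d n f y)) * inverse (multiplicity_gen Z d n (mor Z d n f y))))"
    unfolding eventually_sequentially by blast
  have rat: "eventually_rational (\<lambda>n. of_bool (T n (mor Z d n f y)))"
    if y: "y \<in> obj Z d" and f: "f \<in> FI d (m + d)" for y f
  proof (rule eventually_rational_of_bool_mono[of K])
    fix n assume n: "K \<le> n" and T: "T n (mor Z d n f y)"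
    have n': "N \<le> n" "m + d \<le> n" "m \<le> n" using n unfolding K_def by auto
    have "f \<in> FI d n" using f FI_mono[OF n'(2)] by blast
    then have "mor Z d (Suc n) f y = extend Z n (Suc n) (mor Z d n f y)"
      by (rule mor_eq_extend_mor[OF Z _ _ y]) simp
    moreover have "extend Z m (Suc n) a = extend Z n (Suc n) (extend Z m n a)"
      "extend Z m (Suc n) b = extend Z n (Suc n) (extend Z m n b)"
      using extend_extend[OF Z n'(3), of "Suc n"] a b by simp_all
    ultimately show "T (Suc n) (mor Z d (Suc n) f y)"
      using T R_Suc[OF n'(1)] S_Suc[OF n'(1)] unfolding T_def by simp
  qed
  have rat_gen: "eventually_rational (\<lambda>n. multiplicity_gen Z d n (mor Z d n f y))"
    if y: "y \<in> obj Z d" and f: "f \<in> FI d (m + d)" for y f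
  proof -
    \<comment> \<open>An injection into \<open>[m + d]\<close> produces at each later level the
      extension of one fixed element of \<open>obj Z (m + d)\<close>.\<close>
    have "multiplicity_gen Z d n (mor Z d n f y) =
        multiplicity_gen Z d n (extend Z (m + d) n (mor Z d (m + d) f y))" if "m + d \<le> n" for n
      unfolding mor_eq_extend_mor[OF Z f that y] ..
    then show ?thesis
      by (intro eventually_rational_cong[OF eventually_rational_multiplicity_gen[OF Z mor_in[OF Z f y]]]
          eventually_sequentiallyI)
  qed
  have "eventually_rational (\<lambda>n. poly (c f) (real n) *
      (of_bool (T n (mor Z d n f y)) * inverse (multiplicity_gen Z d n (mor Z d n f y))))"
    if "y \<in> obj Z d" "f \<in> FI d (m + d)" for y f
  proof -
    have 1: "eventually_rational (\<lambda>n. of_bool (T n (mor Z d n f y)))"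
      using that by (rule rat)
    have 2: "eventually_rational (\<lambda>n. inverse (multiplicity_gen Z d n (mor Z d n f y)))"
      by (rule eventually_rational_inverse) (use that in \<open>rule rat_gen\<close>)
    show ?thesis
      by (rule eventually_rational_mult[OF eventually_rational_poly eventually_rational_mult[OF 1 2]])
  qed
  then have "eventually_rational (\<lambda>n. \<Sum>y\<in>obj Z d. \<Sum>f\<in>FI d (m + d). poly (c f) (real n) *
      (of_bool (T n (mor Z d n f y)) * inverse (multiplicity_gen Z d n (mor Z d n f y))))"
    by (intro eventually_rational_sum)
  from eventually_rational_cong[OF this eq] show ?thesis unfolding T_def .
qed

section \<open>The linear system on stable orbits\<close>

lemma pair_orbit_self:
  assumes "is_fi_set Z" "x \<in> obj Z n" "y \<in> obj Z n"
  shows "(x, y) \<in> pair_orbit Z n (x, y)"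
proof -
  have "(x, y) = map_prod (mor Z n n (\<lambda>i\<in>{1..n}. i)) (mor Z n n (\<lambda>i\<in>{1..n}. i)) (x, y)"
    using assms unfolding is_fi_set_def by simp
  then show ?thesis
    unfolding pair_orbit_def by (rule image_eqI[where x = "\<lambda>i\<in>{1..n}. i"]) (rule FI_inclusion, simp)
qed

text \<open>Every morphism in \<open>FI n n\<close> computes \<open>orbit_map Z n n\<close> on the
  orbit of \<open>(x, y)\<close>; here \<sigma> is compared with the identity.\<close>

lemma pair_orbit_mor:
  assumes Z: "is_fi_set Z" and \<sigma>: "\<sigma> \<in> FI n n" and x: "x \<in> obj Z n" and y: "y \<in> obj Z n"
  shows "pair_orbit Z n (mor Z n n \<sigma> x, mor Z n n \<sigma> y) = pair_orbit Z n (x, y)"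
proof -
  have "(\<lambda>i\<in>{1..n}. i) \<in> FI n n" by (rule FI_inclusion) simp
  moreover have "mor Z n n (\<lambda>i\<in>{1..n}. i) x = x" "mor Z n n (\<lambda>i\<in>{1..n}. i) y = y"
    using Z x y unfolding is_fi_set_def by simp_all
  ultimately show ?thesis
    using orbit_map_pair_orbit[OF Z \<sigma> x y] orbit_map_pair_orbit[OF Z _ x y, of "\<lambda>i\<in>{1..n}. i" n]
    by metis
qed

lemma orbits_mem:
  assumes Z: "is_fi_set Z" and A: "A \<in> orbits Z n" and xy: "(x, y) \<in> A"
  shows "x \<in> obj Z n" "y \<in> obj Z n" "A = pair_orbit Z n (x, y)"
proof -
  obtain a b \<sigma> where ab: "a \<in> obj Z n" "b \<in> obj Z n" and A: "A = pair_orbit Z n (a, b)"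
    and \<sigma>: "\<sigma> \<in> FI n n" and x: "x = mor Z n n \<sigma> a" and y: "y = mor Z n n \<sigma> b"
    using A xy unfolding orbits_def pair_orbit_def by auto
  show "x \<in> obj Z n" "y \<in> obj Z n" unfolding x y using mor_in[OF Z \<sigma>] ab by auto
  show "A = pair_orbit Z n (x, y)" unfolding A x y using pair_orbit_mor[OF Z \<sigma>] ab by simp
qed

lemma stable_orbits_mem:
  assumes Z: "is_fi_set Z" and Or: "\<O> \<in> stable_orbits Z" and n: "stable_range Z \<le> n"
    and xy: "(x, y) \<in> \<O> n"
  shows "x \<in> obj Z n" "y \<in> obj Z n" "\<O> n = pair_orbit Z n (x, y)"
proof -
  have "\<O> n \<in> orbits Z n" using Or n unfolding stable_orbits_def by blast
  from orbits_mem[OF Z this xy] show "x \<in> obj Z n" "y \<in> obj Z n" "\<O> n = pair_orbit Z n (x, y)"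
    by auto
qed

lemma stable_orbits_mor_iff:
  assumes Z: "is_fi_set Z" and Or: "\<O> \<in> stable_orbits Z" and n: "stable_range Z \<le> n"
    and \<sigma>: "\<sigma> \<in> FI n n" and x: "x \<in> obj Z n" and y: "y \<in> obj Z n"
  shows "(mor Z n n \<sigma> x, mor Z n n \<sigma> y) \<in> \<O> n \<longleftrightarrow> (x, y) \<in> \<O> n"
  using stable_orbits_mem(3)[OF Z Or n] pair_orbit_mor[OF Z \<sigma> x y] pair_orbit_self[OF Z x y]
    pair_orbit_self[OF Z mor_in[OF Z \<sigma> x] mor_in[OF Z \<sigma> y]] by metis

lemma stable_orbits_extend:
  assumes Z: "is_fi_set Z" and Or: "\<O> \<in> stable_orbits Z" and m: "stable_range Z \<le> m"
    and n: "m \<le> n" and xy: "(x, y) \<in> \<O> m"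
  shows "(extend Z m n x, extend Z m n y) \<in> \<O> n"
proof -
  have "map_prod (extend Z m n) (extend Z m n) (x, y) \<in> orbit_map Z m n (\<O> m)"
    unfolding orbit_map_def extend_def using FI_inclusion[OF n] xy by blast
  moreover have "orbit_map Z m n (\<O> m) = \<O> n" using Or m n unfolding stable_orbits_def by blast
  ultimately show ?thesis by simp
qed

lemma stable_orbits_cover:
  assumes Z: "is_fi_set Z" and fg: "finitely_generated Z" and n: "stable_range Z \<le> n"
    and x: "x \<in> obj Z n" and y: "y \<in> obj Z n"
  shows "\<exists>\<O>\<in>stable_orbits Z. (x, y) \<in> \<O> n"
proof -
  have "pair_orbit Z n (x, y) \<in> orbits Z n" unfolding orbits_def using x y by blast
  then obtain \<O> where "\<O> \<in> stable_orbits Z" "\<O> n = pair_orbit Z n (x, y)"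
    using bij_betw_imp_surj_on[OF stable_orbits_bij[OF Z fg n]] by (metis (no_types, lifting) imageE)
  then show ?thesis using pair_orbit_self[OF Z x y] by auto
qed

lemma stable_orbits_nonempty:
  assumes "is_fi_set Z" "\<O> \<in> stable_orbits Z" "stable_range Z \<le> n"
  shows "\<exists>x y. (x, y) \<in> \<O> n"
proof -
  have "\<O> n \<in> orbits Z n" using assms unfolding stable_orbits_def by blast
  then show ?thesis using pair_orbit_self[OF assms(1)] unfolding orbits_def by blast
qed

text \<open>In the stable range a pair lies in exactly one stable orbit, so one term of the sum
  survives. This makes matrix entries and coefficients interchangeable.\<close>

lemma specialize_stable_orbit:
  assumes Z: "is_fi_set Z" and fg: "finitely_generated Z" and Or: "\<O> \<in> stable_orbits Z"
    and n: "stable_range Z \<le> n" and xy: "(x, y) \<in> \<O> n"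
  shows "specialize Z r n x y = eval_rat (r \<O>) (real n)"
proof -
  have "orbit_relation \<O>' n x y = of_bool (\<O>' = \<O>)" if Or': "\<O>' \<in> stable_orbits Z" for \<O>'
  proof -
    have "\<O>' = \<O>" if "(x, y) \<in> \<O>' n"
    proof -
      have "\<O>' n = \<O> n"
        by (rule trans[OF stable_orbits_mem(3)[OF Z Or' n that] stable_orbits_mem(3)[OF Z Or n xy, symmetric]])
      then show ?thesis
        by (rule inj_onD[OF bij_betw_imp_inj_on[OF stable_orbits_bij[OF Z fg n]] _ Or' Or])
    qed
    then have "(x, y) \<in> \<O>' n \<longleftrightarrow> \<O>' = \<O>" using xy by blast
    then show ?thesis unfolding orbit_relation_def by (rule arg_cong)
  qed
  then have "specialize Z r n x y =
      (\<Sum>\<O>'\<in>stable_orbits Z. eval_rat (r \<O>') (real n) * of_bool (\<O>' = \<O>))"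
    unfolding specialize_def by (intro sum.cong) simp_all
  then show ?thesis
    using finite_stable_orbits[OF Z fg] Or by (simp add: of_bool_def if_distrib cong: if_cong)
qed

lemma specialize_mor:
  assumes Z: "is_fi_set Z" and n: "stable_range Z \<le> n"
    and \<sigma>: "\<sigma> \<in> FI n n" and x: "x \<in> obj Z n" and y: "y \<in> obj Z n"
  shows "specialize Z r n (mor Z n n \<sigma> x) (mor Z n n \<sigma> y) = specialize Z r n x y"
  unfolding specialize_def orbit_relation_def
  using stable_orbits_mor_iff[OF Z _ n \<sigma> x y] by (intro sum.cong) simp_all

text \<open>Expanding \<open>r\<close> over stable orbits leaves counts of intermediate points
  \<open>c\<close>, weighted by rational functions. With \<open>r\<close> the transition relation
  these entries are the coefficients of the linear system.\<close>

lemma eventually_rational_sum_specialize: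
  assumes Z: "is_fi_set Z" and fg: "finitely_generated Z" and Or: "\<O> \<in> stable_orbits Z"
    and a: "a \<in> obj Z m" and b: "b \<in> obj Z m"
  shows "eventually_rational (\<lambda>n. \<Sum>c\<in>obj Z n.
    specialize Z r n (extend Z m n a) c * orbit_relation \<O> n c (extend Z m n b))"
proof -
  let ?C = "\<lambda>\<O>' n. \<Sum>c\<in>obj Z n. of_bool ((extend Z m n a, c) \<in> \<O>' n \<and> (c, extend Z m n b) \<in> \<O> n)"
  have "eventually_rational (?C \<O>')" if Or': "\<O>' \<in> stable_orbits Z" for \<O>'
  proof (rule eventually_rational_count[OF Z fg a b])
    fix n \<sigma> x y assume "stable_range Z \<le> n" "\<sigma> \<in> FI n n" "x \<in> obj Z n" "y \<in> obj Z n"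
    then show "(mor Z n n \<sigma> x, mor Z n n \<sigma> y) \<in> \<O>' n \<longleftrightarrow> (x, y) \<in> \<O>' n"
      "(mor Z n n \<sigma> x, mor Z n n \<sigma> y) \<in> \<O> n \<longleftrightarrow> (x, y) \<in> \<O> n"
      using stable_orbits_mor_iff[OF Z] Or Or' by blast+
  next
    fix n x y assume n: "stable_range Z \<le> n"
    show "(extend Z n (Suc n) x, extend Z n (Suc n) y) \<in> \<O>' (Suc n)" if "(x, y) \<in> \<O>' n"
      by (rule stable_orbits_extend[OF Z Or' n _ that]) simp
    show "(extend Z n (Suc n) x, extend Z n (Suc n) y) \<in> \<O> (Suc n)" if "(x, y) \<in> \<O> n"
      by (rule stable_orbits_extend[OF Z Or n _ that]) simp
  qed
  then have "eventually_rational (\<lambda>n. \<Sum>\<O>'\<in>stable_orbits Z. eval_rat (r \<O>') (real n) * ?C \<O>' n)"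
    by (intro eventually_rational_sum eventually_rational_mult eventually_rational_eval_rat)
  moreover have "(\<Sum>c\<in>obj Z n. specialize Z r n (extend Z m n a) c * orbit_relation \<O> n c (extend Z m n b)) =
      (\<Sum>\<O>'\<in>stable_orbits Z. eval_rat (r \<O>') (real n) * ?C \<O>' n)" for n
    unfolding specialize_def orbit_relation_def sum_distrib_right
    by (subst sum.swap) (simp add: sum_distrib_left of_bool_conj mult.assoc)
  ultimately show ?thesis by simp
qed

text \<open>\<open>A\<close> and \<open>D\<close> are chosen before \<open>v\<close> and \<theta>,
  so that one matrix serves \<theta> = 0, for injectivity, and \<theta> = 1, for hitting times. Each
  equation is evaluated at a representative pair extended from the start of the stable range, and
  invariance spreads it to the whole orbit.\<close>

lemma ex_hitting_system:
  assumes Z: "is_fi_set Z" and fg: "finitely_generated Z"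
  shows "\<exists>A D. \<forall>v \<theta>.
    (\<forall>\<O>\<in>stable_orbits Z. (\<Sum>\<O>'\<in>stable_orbits Z. A \<O> \<O>' * v \<O>') =
      (if \<O> \<in> D then 0 else Fract [:\<theta>:] 1)) \<longrightarrow>
    (\<forall>\<^sub>F n in sequentially. \<forall>x\<in>obj Z n. \<forall>y\<in>obj Z n. specialize Z v n x y =
      (if x = y then 0 else \<theta> + (\<Sum>c\<in>obj Z n. specialize Z P n x c * specialize Z v n c y)))"
proof -
  let ?I = "stable_orbits Z" and ?N = "stable_range Z"
  have fin: "finite ?I" by (rule finite_stable_orbits[OF Z fg])
  have "\<forall>\<O>\<in>?I. \<exists>a b. (a, b) \<in> \<O> ?N" using stable_orbits_nonempty[OF Z] by blast
  then obtain a b where ab: "\<And>\<O>. \<O> \<in> ?I \<Longrightarrow> (a \<O>, b \<O>) \<in> \<O> ?N" by metis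
  have a: "a \<O> \<in> obj Z ?N" and b: "b \<O> \<in> obj Z ?N" if "\<O> \<in> ?I" for \<O>
    using stable_orbits_mem[OF Z that order_refl ab[OF that]] by auto
  define ea where "ea n \<O> = extend Z ?N n (a \<O>)" for n \<O>
  define eb where "eb n \<O> = extend Z ?N n (b \<O>)" for n \<O>
  define k where "k \<O> \<O>' = (SOME q. \<forall>\<^sub>F n in sequentially. (\<Sum>c\<in>obj Z n.
      specialize Z P n (ea n \<O>) c * orbit_relation \<O>' n c (eb n \<O>)) = eval_rat q (real n))" for \<O> \<O>'
  have k: "\<forall>\<^sub>F n in sequentially. (\<Sum>c\<in>obj Z n.
      specialize Z P n (ea n \<O>) c * orbit_relation \<O>' n c (eb n \<O>)) = eval_rat (k \<O> \<O>') (real n)"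
    if "\<O> \<in> ?I" "\<O>' \<in> ?I" for \<O> \<O>'
    unfolding k_def
    by (rule someI_ex)
      (rule eventually_rational_sum_specialize[OF Z fg that(2) a[OF that(1)] b[OF that(1)],
          folded ea_def eb_def, unfolded eventually_rational_def])
  \<comment> \<open>The diagonal orbits. Equality at one level persists under extension, so
    membership decides \<open>ea n \<O> = eb n \<O>\<close> for all large \<open>n\<close>.\<close>
  define D where "D = {\<O>. \<exists>n\<ge>?N. ea n \<O> = eb n \<O>}"
  \<comment> \<open>Rows of diagonal orbits are identity rows and encode the value 0 at the target;
    all other rows are those of the identity minus multiplication by \<open>P\<close> from the
    left.\<close>
  define A where "A \<O> \<O>' = of_bool (\<O>' = \<O>) - (if \<O> \<in> D then 0 else k \<O> \<O>')" for \<O> \<O>'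
  have diag: "\<forall>\<^sub>F n in sequentially. \<O> \<in> D \<longleftrightarrow> ea n \<O> = eb n \<O>" if Or: "\<O> \<in> ?I" for \<O>
  proof (cases "\<O> \<in> D")
    case True
    then obtain m where m: "?N \<le> m" "ea m \<O> = eb m \<O>" unfolding D_def by blast
    have "ea n \<O> = eb n \<O>" if "m \<le> n" for n
      using extend_extend[OF Z m(1) that] a[OF Or] b[OF Or] m(2) unfolding ea_def eb_def by metis
    with True show ?thesis unfolding eventually_sequentially by blast
  next
    case False
    then show ?thesis unfolding eventually_sequentially D_def by blast
  qed
  have "\<forall>\<^sub>F n in sequentially. \<forall>x\<in>obj Z n. \<forall>y\<in>obj Z n. specialize Z v n x y =
      (if x = y then 0 else \<theta> + (\<Sum>c\<in>obj Z n. specialize Z P n x c * specialize Z v n c y))"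
    if sys: "\<forall>\<O>\<in>?I. (\<Sum>\<O>'\<in>?I. A \<O> \<O>' * v \<O>') = (if \<O> \<in> D then 0 else Fract [:\<theta>:] 1)" for v \<theta>
  proof -
    have v: "v \<O> = (if \<O> \<in> D then 0 else Fract [:\<theta>:] 1 + (\<Sum>\<O>'\<in>?I. k \<O> \<O>' * v \<O>'))"
      if Or: "\<O> \<in> ?I" for \<O>
    proof -
      have "(\<Sum>\<O>'\<in>?I. A \<O> \<O>' * v \<O>') =
          (\<Sum>\<O>'\<in>?I. of_bool (\<O>' = \<O>) * v \<O>') - (if \<O> \<in> D then 0 else (\<Sum>\<O>'\<in>?I. k \<O> \<O>' * v \<O>'))"
        unfolding A_def by (simp add: left_diff_distrib sum_subtractf)
      also have "(\<Sum>\<O>'\<in>?I. of_bool (\<O>' = \<O>) * v \<O>') = v \<O>"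
        using fin Or by (simp add: of_bool_def if_distrib[of "\<lambda>x. x * _"] cong: if_cong)
      finally show ?thesis using sys Or by (auto simp: algebra_simps split: if_splits)
    qed
    have eval_v: "\<forall>\<^sub>F n in sequentially. eval_rat (v \<O>) (real n) = (if ea n \<O> = eb n \<O> then 0 else
        \<theta> + (\<Sum>c\<in>obj Z n. specialize Z P n (ea n \<O>) c * specialize Z v n c (eb n \<O>)))"
      if Or: "\<O> \<in> ?I" for \<O>
    proof -
      have "\<forall>\<^sub>F n in sequentially. \<forall>\<O>'\<in>?I. eval_rat (k \<O> \<O>' * v \<O>') (real n) =
        eval_rat (k \<O> \<O>') (real n) * eval_rat (v \<O>') (real n)"
        using fin eventually_eval_rat_mult by (simp add: eventually_ball_finite)
      moreover have "\<forall>\<^sub>F n in sequentially. \<forall>\<O>'\<in>?I. (\<Sum>c\<in>obj Z n.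
        specialize Z P n (ea n \<O>) c * orbit_relation \<O>' n c (eb n \<O>)) = eval_rat (k \<O> \<O>') (real n)"
        using fin k[OF Or] by (simp add: eventually_ball_finite)
      moreover note diag[OF Or] eventually_eval_rat_const[of \<theta>]
        eventually_eval_rat_sum[OF fin, of "\<lambda>\<O>'. k \<O> \<O>' * v \<O>'"]
        eventually_eval_rat_add[of "Fract [:\<theta>:] 1" "\<Sum>\<O>'\<in>?I. k \<O> \<O>' * v \<O>'"]
      ultimately show ?thesis
      proof eventually_elim
        case (elim n)
        show ?case
        proof (cases "\<O> \<in> D")
          case True
          then have "v \<O> = 0" using v[OF Or] by simp
          then show ?thesis using True elim(3) by (simp add: eval_rat_def)
        next
          case False
          then have "eval_rat (v \<O>) (real n) =
              \<theta> + (\<Sum>\<O>'\<in>?I. eval_rat (k \<O> \<O>') (real n) * eval_rat (v \<O>') (real n))"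
            using v[OF Or] elim(1,4,5,6) by simp
          also have "(\<Sum>\<O>'\<in>?I. eval_rat (k \<O> \<O>') (real n) * eval_rat (v \<O>') (real n)) =
              (\<Sum>\<O>'\<in>?I. \<Sum>c\<in>obj Z n. specialize Z P n (ea n \<O>) c *
                (eval_rat (v \<O>') (real n) * orbit_relation \<O>' n c (eb n \<O>)))"
            using elim(2) by (intro sum.cong) (auto simp: sum_distrib_right sum_distrib_left mult_ac
                simp flip: elim(2)[rule_format])
          also have "\<dots> = (\<Sum>c\<in>obj Z n. specialize Z P n (ea n \<O>) c * specialize Z v n c (eb n \<O>))"
            by (subst sum.swap) (simp add: specialize_def sum_distrib_left)
          finally show ?thesis using False elim(3) by simp
        qed
      qed
    qed
    then have "\<forall>\<^sub>F n in sequentially. \<forall>\<O>\<in>?I. eval_rat (v \<O>) (real n) = (if ea n \<O> = eb n \<O> then 0 else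
        \<theta> + (\<Sum>c\<in>obj Z n. specialize Z P n (ea n \<O>) c * specialize Z v n c (eb n \<O>)))"
      using fin by (simp add: eventually_ball_finite)
    then show ?thesis
      using eventually_ge_at_top[of ?N]
    proof eventually_elim
      case (elim n)
      show ?case
      proof (intro ballI)
        fix x y assume x: "x \<in> obj Z n" and y: "y \<in> obj Z n"
        obtain \<O> where Or: "\<O> \<in> ?I" and xy: "(x, y) \<in> \<O> n"
          using stable_orbits_cover[OF Z fg elim(2) x y] by blast
        have e: "(ea n \<O>, eb n \<O>) \<in> \<O> n"
          unfolding ea_def eb_def by (rule stable_orbits_extend[OF Z Or order_refl elim(2) ab[OF Or]])
        note ea_in = stable_orbits_mem(1)[OF Z Or elim(2) e]
          and eb_in = stable_orbits_mem(2)[OF Z Or elim(2) e]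
        have "(x, y) \<in> pair_orbit Z n (ea n \<O>, eb n \<O>)"
          using xy stable_orbits_mem(3)[OF Z Or elim(2) e] by simp
        then obtain \<sigma> where \<sigma>: "\<sigma> \<in> FI n n" and xe: "x = mor Z n n \<sigma> (ea n \<O>)"
          and ye: "y = mor Z n n \<sigma> (eb n \<O>)"
          unfolding pair_orbit_def by auto
        \<comment> \<open>Both factors are invariant under simultaneous permutation, so reindexing
          by \<sigma> moves the sum from \<open>(x, y)\<close> to the representative pair.\<close>
        have "(\<Sum>c\<in>obj Z n. specialize Z P n x c * specialize Z v n c y) =
            (\<Sum>c\<in>obj Z n. specialize Z P n x (mor Z n n \<sigma> c) * specialize Z v n (mor Z n n \<sigma> c) y)"
          by (rule sum.reindex_bij_betw[OF mor_bij_betw[OF Z \<sigma>], symmetric])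
        also have "\<dots> = (\<Sum>c\<in>obj Z n. specialize Z P n (ea n \<O>) c * specialize Z v n c (eb n \<O>))"
          unfolding xe ye using specialize_mor[OF Z elim(2) \<sigma>] ea_in eb_in by (intro sum.cong) simp_all
        finally have "(\<Sum>c\<in>obj Z n. specialize Z P n x c * specialize Z v n c y) =
          (\<Sum>c\<in>obj Z n. specialize Z P n (ea n \<O>) c * specialize Z v n c (eb n \<O>))" .
        moreover have "x = y \<longleftrightarrow> ea n \<O> = eb n \<O>"
          unfolding xe ye
          by (rule inj_on_eq_iff[OF bij_betw_imp_inj_on[OF mor_bij_betw[OF Z \<sigma>]] ea_in eb_in])
        moreover have "specialize Z v n x y = eval_rat (v \<O>) (real n)"
          by (rule specialize_stable_orbit[OF Z fg Or elim(2) xy])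
        ultimately show "specialize Z v n x y = (if x = y then 0 else
            \<theta> + (\<Sum>c\<in>obj Z n. specialize Z P n x c * specialize Z v n c y))"
          using elim(1) Or by simp
      qed
    qed
  qed
  then show ?thesis by blast
qed

theorem theorem4p8:
  fixes Z :: "'a fi_set"
    and P :: "'a vrel"
    and M :: "nat \<Rightarrow> 'w measure"
    and X :: "nat \<Rightarrow> nat \<Rightarrow> 'w \<Rightarrow> 'a"
  assumes "is_fi_set Z"
    and "finitely_generated Z"
    and "fi_markov_chain Z P M X"
    and "connected_chain Z M X"
  shows "(\<exists>Q\<in>virtual_relations Z. \<forall>\<^sub>F n in sequentially. \<forall>a\<in>obj Z n. \<forall>b\<in>obj Z n.
            enn2ereal (hitting_matrix (M n) (X n) a b) = ereal (specialize Z Q n a b)) \<and>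
         (\<forall>\<O>\<in>stable_orbits Z. \<exists>q :: real poly fract. \<forall>\<^sub>F n in sequentially. \<forall>(a, b)\<in>\<O> n.
            enn2ereal (hitting_matrix (M n) (X n) a b) = ereal (eval_rat q (real n)))"
proof -
  note Z = assms(1) and fg = assms(2)
  let ?I = "stable_orbits Z" and ?N = "stable_range Z"
  have fin: "finite ?I" by (rule finite_stable_orbits[OF Z fg])
  have "\<forall>\<^sub>F n in sequentially. (\<forall>\<O>\<in>?I. eval_rat (P \<O>) (real n) \<in> {0..1}) \<and>
      (\<forall>a\<in>obj Z n. (\<Sum>b\<in>obj Z n. specialize Z P n a b) = 1)"
    and "\<forall>\<^sub>F n in sequentially. obj Z n \<noteq> {} \<longrightarrow>
      markov_chain (obj Z n) (specialize Z P n) (M n) (X n)"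
    and "\<forall>\<^sub>F n in sequentially. irreducible_chain (obj Z n) (M n) (X n)"
    using assms unfolding fi_markov_chain_def transition_relation_def connected_chain_def by auto
  then have chain: "\<forall>\<^sub>F n in sequentially. (\<forall>a b. 0 \<le> specialize Z P n a b) \<and>
      (\<forall>a\<in>obj Z n. (\<Sum>b\<in>obj Z n. specialize Z P n a b) = 1) \<and>
      (obj Z n \<noteq> {} \<longrightarrow> markov_chain (obj Z n) (specialize Z P n) (M n) (X n)) \<and>
      irreducible_chain (obj Z n) (M n) (X n)"
  proof eventually_elim
    case (elim n)
    have "0 \<le> specialize Z P n a b" for a b
      using elim(1) unfolding specialize_def orbit_relation_def by (intro sum_nonneg) simp
    with elim show ?case by blast
  qed
  obtain A D where sys: "\<And>v \<theta>.
    \<forall>\<O>\<in>?I. (\<Sum>\<O>'\<in>?I. A \<O> \<O>' * v \<O>') = (if \<O> \<in> D then 0 else Fract [:\<theta>:] 1) \<Longrightarrow>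
    \<forall>\<^sub>F n in sequentially. \<forall>x\<in>obj Z n. \<forall>y\<in>obj Z n. specialize Z v n x y =
      (if x = y then 0 else \<theta> + (\<Sum>c\<in>obj Z n. specialize Z P n x c * specialize Z v n c y))"
    using ex_hitting_system[OF Z fg, of P] by (elim exE) blast
  have "\<exists>v. \<forall>\<O>\<in>?I. (\<Sum>\<O>'\<in>?I. A \<O> \<O>' * v \<O>') = (if \<O> \<in> D then 0 else Fract [:1:] 1)"
  proof (rule injective_system_solvable[OF fin], rule ballI)
    fix v \<O> assume 0: "\<forall>\<O>\<in>?I. (\<Sum>\<O>'\<in>?I. A \<O> \<O>' * v \<O>') = 0" and Or: "\<O> \<in> ?I"
    \<comment> \<open>A kernel vector solves the system for \<theta> = 0, where the right-hand side
      vanishes in every row.\<close>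
    have "\<forall>\<^sub>F n in sequentially. \<forall>x\<in>obj Z n. \<forall>y\<in>obj Z n. specialize Z v n x y =
      (if x = y then 0 else 0 + (\<Sum>c\<in>obj Z n. specialize Z P n x c * specialize Z v n c y))"
      by (rule sys) (use 0 in \<open>simp add: fract_collapse\<close>)
    then have "\<forall>\<^sub>F n in sequentially. eval_rat (v \<O>) (real n) = 0"
      using chain eventually_ge_at_top[of ?N]
    proof eventually_elim
      case (elim n)
      obtain x y where xy: "(x, y) \<in> \<O> n" using stable_orbits_nonempty[OF Z Or elim(3)] by blast
      have x: "x \<in> obj Z n" and y: "y \<in> obj Z n" using stable_orbits_mem[OF Z Or elim(3) xy] by auto
      have "markov_chain (obj Z n) (specialize Z P n) (M n) (X n)" using elim(2) x by blast
      from harmonic_eq_zero[OF this _ finite_obj[OF Z] _ y _ _ x, of "\<lambda>x. specialize Z v n x y"]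
      have "specialize Z v n x y = 0" using elim(1,2) y by simp
      then show ?case using specialize_stable_orbit[OF Z fg Or elim(3) xy] by simp
    qed
    then show "v \<O> = 0" by (rule eval_rat_eventually_0_imp_0)
  qed
  then obtain v where "\<forall>\<O>\<in>?I. (\<Sum>\<O>'\<in>?I. A \<O> \<O>' * v \<O>') = (if \<O> \<in> D then 0 else Fract [:1:] 1)"
    by blast
  from sys[OF this] have hit: "\<forall>\<^sub>F n in sequentially. \<forall>a\<in>obj Z n. \<forall>b\<in>obj Z n.
      enn2ereal (hitting_matrix (M n) (X n) a b) = ereal (specialize Z v n a b)"
    using chain
  proof eventually_elim
    case (elim n)
    show ?case
    proof (intro ballI)
      fix a b assume a: "a \<in> obj Z n" and b: "b \<in> obj Z n"
      have "markov_chain (obj Z n) (specialize Z P n) (M n) (X n)" using elim(2) a by blast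
      then show "enn2ereal (hitting_matrix (M n) (X n) a b) = ereal (specialize Z v n a b)"
        by (rule enn2ereal_hitting_matrix_eq[OF _ finite_obj[OF Z] _ _ _ _ a,
              where g = "\<lambda>x. specialize Z v n x b"]) (use elim b in simp_all)
    qed
  qed
  \<comment> \<open>Virtual relations are extensional families, whereas \<open>v\<close> is
    arbitrary off the stable orbits; specialization sees only its values on them.\<close>
  have "specialize Z (restrict v ?I) n a b = specialize Z v n a b" for n a b
    unfolding specialize_def by (intro sum.cong) simp_all
  then have "\<forall>\<^sub>F n in sequentially. \<forall>a\<in>obj Z n. \<forall>b\<in>obj Z n.
      enn2ereal (hitting_matrix (M n) (X n) a b) = ereal (specialize Z (restrict v ?I) n a b)"
    using hit by simp
  moreover have "restrict v ?I \<in> virtual_relations Z" unfolding virtual_relations_def by simp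
  \<comment> \<open>The entry on an orbit is the coefficient of that orbit, so \<open>v \<O>\<close>
    itself is the required rational function.\<close>
  moreover have "\<forall>\<^sub>F n in sequentially. \<forall>(a, b)\<in>\<O> n.
      enn2ereal (hitting_matrix (M n) (X n) a b) = ereal (eval_rat (v \<O>) (real n))"
    if Or: "\<O> \<in> ?I" for \<O>
    using hit eventually_ge_at_top[of ?N]
  proof eventually_elim
    case (elim n)
    show ?case
    proof clarify
      fix a b assume ab: "(a, b) \<in> \<O> n"
      show "enn2ereal (hitting_matrix (M n) (X n) a b) = ereal (eval_rat (v \<O>) (real n))"
        using elim(1) stable_orbits_mem[OF Z Or elim(2) ab] specialize_stable_orbit[OF Z fg Or elim(2) ab]
        by simp
    qed
  qed
  ultimately show ?thesis by blast
qed

end
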